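(* Let $n=k=2$. Let $r_{ji}=r_{ji}(x)$ ($i,j\in\mathbb{Z}_+^2$, $|i|\le4$, $|j|\ge5$) be the universal (i.e. independent of $g$) rational functions of $x=(x_\iota)_{|\iota|\le4}\in\mathbb{R}^{15}$ constructed in the context. Let $g=(g_i)_{|i|\le4}\in G_0$, let $\lambda^*=\lambda^*_g$, let $p_g(t)=\sum_{|i|\le4}\lambda_i^*t^i$, and for $|j|\ge5$ let $g_j:=\int_{\mathbb{R}^2}t^je^{p_g(t)}\,dt$ be the higher order moments of the maximum entropy density $e^{p_g}$. Then $$g_j=\sum_{|i|\le4}r_{ji}(\lambda^* )\,g_i\qquad(j\in\mathbb{Z}_+^2,\ |j|\ge5).$$
   Context: Notation: $\mathbb{Z}_+=\{0,1,2,\dots\}$; for $i=(i_1,i_2)\in\mathbb{Z}_+^2$, $t^i=t_1^{i_1}t_2^{i_2}$ and $|i|=i_1+i_2$; inequalities between multiindices are componentwise; $e_1=(1,0)$, $e_2=(0,1)$; $x_{ab}$ means $x_{(a,b)}$; there are 15 multiindices $i\in\mathbb{Z}_+^2$ with $|i|\le4$. The sets $G$, $G_0$. A vector $g=(g_i)_{|i|\le4}\in\mathbb{R}^{15}$ has a representing density on $\mathbb{R}^2$ if there is a Lebesgue measurable $f\ge0$ a.e. on $\mathbb{R}^2$ with $\int|t^i|f\,dt<\infty$ and $\int t^if\,dt=g_i$ for all $|i|\le4$, where $f$ is not a.e. zero (the total mass $g_{(0,0)}>0$ is not required to be $1$). For such $g$, $\lambda^*=\lambda^*_g=(\lambda^*_i)_{|i|\le4}$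 denotes the (existing, unique) vector maximizing $L_0(\lambda)=\sum_{|i|\le4}g_i\lambda_i-\int_{\mathbb{R}^2}e^{\sum_{|i|\le4}\lambda_it^i}dt\in[-\infty,\infty)$ over $\lambda\in\mathbb{R}^{15}$. $G$ is the set of all such $g$ for which $\sum_{|i|=4}\lambda_i^*t^i<0$ for all $t\in\mathbb{R}^2\setminus\{0\}$. For $g\in G$, $e^{p_g}$ is a representing density of $g$. For $x=(x_i)_{|i|\le4}\in\mathbb{R}^{15}$ let $$A(x)=\begin{bmatrix} 4x_{40} & 0 & 0 & x_{31} & 0 & 0 \\ 3x_{31} & 4x_{40} & 0 & 2x_{22} & x_{31} & 0 \\ 2x_{22} & 3x_{31} & 4x_{40} & 3x_{13} & 2x_{22} & x_{31} \\ x_{13} & 2x_{22} & 3x_{31} & 4x_{04} & 3x_{13} & 2x_{22} \\ 0 & x_{13} & 2x_{22} & 0 & 4x_{04} & 3x_{13} \\ 0 & 0 & x_{13} & 0 & 0 & 4x_{04} \end{bmatrix},$$ and let $G_0=\{g\in G:\det A(\lambda^*_g)\ne0\}$. (For $g\in G$ one has $\lambda^*_{(4,0)}<0$.) Construction of $r_{ji}(x)$, for $x$ with $x_{40}\ne0$ and $\det A(x)\neq0$. Put $x_\kappa=0$ if $\kappa\not\ge0$. Fix $j_0\in\mathbb{Z}_+^2$ with $|j_0|\ge5$ and let $l=|j_0|-1\ge4$. For $0\le q\le l+1$ let $\delta_q=1$ if $j_0=(l+1-q,q)$ and $\delta_q=0$ otherwise. Define numbers $\alpha_q,\beta_q$ ($0\le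 q\le l-2$), with $\alpha_q=\beta_q=0$ for $q<0$ and for $q\ge l-1$, as follows. If $l\ge5$, put $\alpha_0=\dots=\alpha_{l-5}=0$ and define $\beta_0,\dots,\beta_{l-5}$ inductively by $$4x_{40}\beta_q=-\sum_{p=0}^{q-1}(4+p-q)\,x_{(4+p-q,\,q-p)}\,\beta_p+\delta_q\qquad(0\le q\le l-5).$$ Put $y=-3x_{31}\beta_{l-5}-2x_{22}\beta_{l-6}-x_{13}\beta_{l-7}$, $z=-2x_{22}\beta_{l-5}-x_{13}\beta_{l-6}$, $w=-x_{13}\beta_{l-5}$ (so $y=z=w=0$ if $l=4$), and determine the remaining $\alpha_q,\beta_q$ from $$A(x)\,(\beta_{l-4},\beta_{l-3},\beta_{l-2},-\alpha_{l-4},-\alpha_{l-3},-\alpha_{l-2})^{T}=(y+\delta_{l-4},\,z+\delta_{l-3},\,w+\delta_{l-2},\,\delta_{l-1},\,\delta_l,\,\delta_{l+1})^{T}.$$ Put $a_{(l-2-q,q)}=\alpha_q$, $b_{(l-2-q,q)}=\beta_q$ for $0\le q\le l-2$. For $i\in\mathbb{Z}_+^2$ with $|i|\le l$ let $I_i=\{\kappa\in\mathbb{Z}_+^2:\kappa\le i,\ |\kappa|=|i|+2-l\}$ and $$c_{j_0i}(x)=\sum_{\kappa\in I_i}\big[(\kappa_2+1)x_{\kappa+e_2}a_{i-\kappa}-(\kappa_1+1)x_{\kappa+e_1}b_{i-\kappa}\big]+d_{j_0i},$$ where $d_{j_0i}=(i_2+1)a_{i+e_2}-(i_1+1)b_{i+e_1}$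 if $|i|=l-3$ and $d_{j_0i}=0$ otherwise. Finally, for $|i|\le4$ put $r_{\iota i}(x)=1$ if $\iota=i$ and $0$ otherwise when $|\iota|\le4$, and define recursively on $|j|$ $$r_{ji}(x)=\sum_{|\iota|<|j|}c_{j\iota}(x)\,r_{\iota i}(x)\qquad(|j|\ge5).$$ *)

theory Defs
  imports "HOL-Analysis.Analysis"
begin

type_synonym mindex = "nat \<times> nat"

definition mabs :: "mindex \<Rightarrow> nat"
  where "mabs i = fst i + snd i"

definition mpow :: "real \<times> real \<Rightarrow> mindex \<Rightarrow> real"
  where "mpow t i = fst t ^ fst i * snd t ^ snd i"

text \<open>A vector of \<open>\<real>\<^sup>1\<^sup>5\<close>, indexed by the 15 multiindices of length at most 4, is a function
  that vanishes at all other multiindices.\<close>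

definition R15 :: "(mindex \<Rightarrow> real) set"
  where "R15 = {x. \<forall>i. 4 < mabs i \<longrightarrow> x i = 0}"

definition quartic :: "(mindex \<Rightarrow> real) \<Rightarrow> real \<times> real \<Rightarrow> real"
  where "quartic x t = (\<Sum>i | mabs i \<le> 4. x i * mpow t i)"

definition representing_density :: "(real \<times> real \<Rightarrow> real) \<Rightarrow> (mindex \<Rightarrow> real) \<Rightarrow> bool"
  where "representing_density f g \<longleftrightarrow>
    f \<in> borel_measurable lebesgue \<and>
    (AE t in lebesgue. 0 \<le> f t) \<and>
    \<not> (AE t in lebesgue. f t = 0) \<and>
    (\<forall>i. mabs i \<le> 4 \<longrightarrow>
      integrable lebesgue (\<lambda>t. \<bar>mpow t i\<bar> * f t) \<and>
      (LINT t|lebesgue. mpow t i * f t) = g i)"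

definition L0 :: "(mindex \<Rightarrow> real) \<Rightarrow> (mindex \<Rightarrow> real) \<Rightarrow> ereal"
  where "L0 g x = ereal (\<Sum>i | mabs i \<le> 4. g i * x i)
    - enn2ereal (\<integral>\<^sup>+t. ennreal (exp (quartic x t)) \<partial>lebesgue)"

definition lambda_star :: "(mindex \<Rightarrow> real) \<Rightarrow> (mindex \<Rightarrow> real)"
  where "lambda_star g = (THE x. x \<in> R15 \<and> (\<forall>y\<in>R15. L0 g y \<le> L0 g x))"

definition G :: "(mindex \<Rightarrow> real) set"
  where "G = {g \<in> R15. (\<exists>f. representing_density f g) \<and>
    (\<forall>t. t \<noteq> 0 \<longrightarrow> (\<Sum>i | mabs i = 4. lambda_star g i * mpow t i) < 0)}"

definition A :: "(mindex \<Rightarrow> real) \<Rightarrow> real^6^6"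
  where "A x = vector [
    vector [4 * x (4,0), 0, 0, x (3,1), 0, 0],
    vector [3 * x (3,1), 4 * x (4,0), 0, 2 * x (2,2), x (3,1), 0],
    vector [2 * x (2,2), 3 * x (3,1), 4 * x (4,0), 3 * x (1,3), 2 * x (2,2), x (3,1)],
    vector [x (1,3), 2 * x (2,2), 3 * x (3,1), 4 * x (0,4), 3 * x (1,3), 2 * x (2,2)],
    vector [0, x (1,3), 2 * x (2,2), 0, 4 * x (0,4), 3 * x (1,3)],
    vector [0, 0, x (1,3), 0, 0, 4 * x (0,4)]]"

definition G0 :: "(mindex \<Rightarrow> real) set"
  where "G0 = {g \<in> G. det (A (lambda_star g)) \<noteq> 0}"

text \<open>In the following, \<open>j\<close> is a multiindex with \<open>mabs j \<ge> 5\<close>, and \<open>l = mabs j - 1\<close>. Indices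
  such as \<open>l - 6\<close> may be negative; they are therefore integers where this matters, the
  corresponding quantities being 0.\<close>

definition ext :: "(mindex \<Rightarrow> real) \<Rightarrow> int \<Rightarrow> int \<Rightarrow> real"
  where "ext x m n = (if 0 \<le> m \<and> 0 \<le> n then x (nat m, nat n) else 0)"

definition delta :: "mindex \<Rightarrow> nat \<Rightarrow> real"
  where "delta j q = (if q \<le> mabs j \<and> j = (mabs j - q, q) then 1 else 0)"

text \<open>The solution of the recursion for \<open>\<beta>\<^sub>q\<close>, meant for \<open>q \<le> l - 5\<close> only.\<close>

fun beta_rec :: "(mindex \<Rightarrow> real) \<Rightarrow> mindex \<Rightarrow> nat \<Rightarrow> real"
  where "beta_rec x j q =
    (- (\<Sum>p\<in>{..<q}. of_int (4 + int p - int q) * ext x (4 + int p - int q) (int q - int p)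
          * beta_rec x j p) + delta j q) / (4 * x (4,0))"

declare beta_rec.simps [simp del]

definition beta_low :: "(mindex \<Rightarrow> real) \<Rightarrow> mindex \<Rightarrow> int \<Rightarrow> real"
  where "beta_low x j q =
    (if 0 \<le> q \<and> q \<le> int (mabs j) - 6 then beta_rec x j (nat q) else 0)"

definition rhs :: "(mindex \<Rightarrow> real) \<Rightarrow> mindex \<Rightarrow> real^6"
  where "rhs x j =
    (let l = mabs j - 1;
         y = - 3 * x (3,1) * beta_low x j (int l - 5) - 2 * x (2,2) * beta_low x j (int l - 6)
             - x (1,3) * beta_low x j (int l - 7);
         z = - 2 * x (2,2) * beta_low x j (int l - 5) - x (1,3) * beta_low x j (int l - 6);
         w = - x (1,3) * beta_low x j (int l - 5)
     in vector [y + delta j (l - 4), z + delta j (l - 3), w + delta j (l - 2),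
                delta j (l - 1), delta j l, delta j (l + 1)])"

text \<open>The vector \<open>(\<beta>\<^sub>l\<^sub>-\<^sub>4, \<beta>\<^sub>l\<^sub>-\<^sub>3, \<beta>\<^sub>l\<^sub>-\<^sub>2, -\<alpha>\<^sub>l\<^sub>-\<^sub>4, -\<alpha>\<^sub>l\<^sub>-\<^sub>3, -\<alpha>\<^sub>l\<^sub>-\<^sub>2)\<close>, which is well defined if
  \<open>det (A x) \<noteq> 0\<close>.\<close>

definition sol :: "(mindex \<Rightarrow> real) \<Rightarrow> mindex \<Rightarrow> real^6"
  where "sol x j = (THE v. A x *v v = rhs x j)"

definition alpha :: "(mindex \<Rightarrow> real) \<Rightarrow> mindex \<Rightarrow> nat \<Rightarrow> real"
  where "alpha x j q =
    (let l = mabs j - 1 in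
     if q = l - 4 then - (sol x j $ 4)
     else if q = l - 3 then - (sol x j $ 5)
     else if q = l - 2 then - (sol x j $ 6)
     else 0)"

definition beta :: "(mindex \<Rightarrow> real) \<Rightarrow> mindex \<Rightarrow> nat \<Rightarrow> real"
  where "beta x j q =
    (let l = mabs j - 1 in
     if q = l - 4 then sol x j $ 1
     else if q = l - 3 then sol x j $ 2
     else if q = l - 2 then sol x j $ 3
     else beta_low x j (int q))"

definition a_coeff :: "(mindex \<Rightarrow> real) \<Rightarrow> mindex \<Rightarrow> mindex \<Rightarrow> real"
  where "a_coeff x j i = (if mabs i = mabs j - 3 then alpha x j (snd i) else 0)"

definition b_coeff :: "(mindex \<Rightarrow> real) \<Rightarrow> mindex \<Rightarrow> mindex \<Rightarrow> real"
  where "b_coeff x j i = (if mabs i = mabs j - 3 then beta x j (snd i) else 0)"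

text \<open>The condition \<open>|\<kappa>| = |i| + 2 - l\<close> is written without subtraction, so that the set is
  empty when \<open>|i| + 2 < l\<close>.\<close>

definition I_set :: "nat \<Rightarrow> mindex \<Rightarrow> mindex set"
  where "I_set l i =
    {k. fst k \<le> fst i \<and> snd k \<le> snd i \<and> mabs k + l = mabs i + 2}"

definition d_coeff :: "(mindex \<Rightarrow> real) \<Rightarrow> mindex \<Rightarrow> mindex \<Rightarrow> real"
  where "d_coeff x j i =
    (if mabs i = mabs j - 1 - 3
     then real (snd i + 1) * a_coeff x j (fst i, snd i + 1)
        - real (fst i + 1) * b_coeff x j (fst i + 1, snd i)
     else 0)"

definition c_coeff :: "(mindex \<Rightarrow> real) \<Rightarrow> mindex \<Rightarrow> mindex \<Rightarrow> real"
  where "c_coeff x j i =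
    (\<Sum>k\<in>I_set (mabs j - 1) i.
        real (snd k + 1) * x (fst k, snd k + 1) * a_coeff x j (fst i - fst k, snd i - snd k)
      - real (fst k + 1) * x (fst k + 1, snd k) * b_coeff x j (fst i - fst k, snd i - snd k))
    + d_coeff x j i"

function r :: "(mindex \<Rightarrow> real) \<Rightarrow> mindex \<Rightarrow> mindex \<Rightarrow> real"
  where "r x j i =
    (if mabs j \<le> 4 then (if j = i then 1 else 0)
     else (\<Sum>m\<in>{m. mabs m < mabs j}. c_coeff x j m * r x m i))"
  by pat_completeness auto
termination
  by (relation "Wellfounded.measure (\<lambda>(x, j, i). mabs j)") auto

declare r.simps [simp del]

end

theory Submission
  imports Defs "HOL-Real_Asymp.Real_Asymp" "HOL-Probability.Sinc_Integral"
begin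

text \<open>
Write \<open>q\<close> for the quartic polynomial with coefficient vector \<open>\<lambda>*\<close>, \<open>h\<close> for its leading form and
\<open>M\<^sub>i\<close> for the integral of \<open>t\<^sup>i e\<^sup>q\<close> over the plane. The formula is the conjunction of two independent facts.

The first is an algebraic relation between the moments of \<open>e\<^sup>q\<close>. Since \<open>e\<^sup>q\<close> decays rapidly, for all
polynomials \<open>a\<close> and \<open>b\<close> the divergence \<open>\<partial>\<^sub>2(a e\<^sup>q) - \<partial>\<^sub>1(b e\<^sup>q)\<close> has integral 0
(\<open>integration_by_parts\<close>). If \<open>a\<close> and \<open>b\<close> are homogeneous of degree \<open>|j| - 3\<close>, this divergence is
\<open>e\<^sup>q\<close> times a polynomial of degree \<open>|j|\<close> whose leading form is \<open>a \<partial>\<^sub>2h - b \<partial>\<^sub>1h\<close>. The recursion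
for \<open>\<beta>\<close> and the linear system with matrix \<open>A\<close> are the comparison of coefficients in
\<open>b \<partial>\<^sub>1h - a \<partial>\<^sub>2h = t\<^sup>j\<close> (\<open>top_degree_coefficient\<close>), so what remains of the vanishing integral is
\<open>-M\<^sub>j\<close> plus a combination of moments of lower order, with the numbers \<open>c\<^sub>j\<^sub>m\<close> as coefficients
(\<open>moment_reduction\<close>). Iterating this reduction down to order 4 gives the numbers \<open>r\<^sub>j\<^sub>i\<close>
(\<open>moments_by_r\<close>).

The second fact is \<open>M\<^sub>i = g\<^sub>i\<close> for \<open>|i| \<le> 4\<close>. Here \<open>\<lambda>*\<close> is only given as the maximizer of
\<open>L\<^sub>0\<close>, so one must know that exactly one maximizer exists. The functional is upper semicontinuous by
Fatou's lemma, and its superlevel sets are bounded (\<open>L0_superlevel_bounded\<close>): along a direction \<open>p\<close>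
that is positive somewhere the exponential integral outgrows the linear part, and along any other
direction the linear part, being the integral of \<open>p\<close> against a representing density, tends to
\<open>-\<infinity>\<close>. Hence a maximizer exists; strict convexity of the exponential makes it unique. Because \<open>h\<close>
is negative definite, \<open>L\<^sub>0\<close> is finite in a neighbourhood of \<open>\<lambda>*\<close>, and the vanishing of its partial
derivatives there says that the moments are the \<open>g\<^sub>i\<close> (\<open>moments_at_maximizer\<close>).
\<close>

section \<open>Monomials and quartic polynomials\<close>

lemma finite_mabs_le [simp]: "finite {i. mabs i \<le> n}"
  by (rule finite_subset[of _ "{..n} \<times> {..n}"]) (auto simp: mabs_def)

lemma finite_mabs_eq [simp]: "finite {i. mabs i = n}"
  by (rule finite_subset[OF _ finite_mabs_le[of n]]) auto

lemma finite_I_set [simp]: "finite (I_set l i)"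
  by (rule finite_subset[of _ "{..fst i} \<times> {..snd i}"]) (auto simp: I_set_def)

lemma power_le_one_plus_power:
  fixes u :: real
  assumes "0 \<le> u" and "m \<le> n"
  shows "u ^ m \<le> 1 + u ^ n"
proof (cases "u \<le> 1")
  case True
  then have "u ^ m \<le> 1" using assms by (intro power_le_one) auto
  moreover have "0 \<le> u ^ n" using assms by simp
  ultimately show ?thesis by linarith
next
  case False
  then have "u ^ m \<le> u ^ n" using assms by (intro power_increasing) auto
  then show ?thesis by simp
qed

lemma abs_mpow_le: "\<bar>mpow t i\<bar> \<le> norm t ^ mabs i"
proof -
  have "\<bar>fst t\<bar> \<le> norm t" "\<bar>snd t\<bar> \<le> norm t"
    using norm_fst_le[of "fst t" "snd t"] norm_snd_le[of "snd t" "fst t"] by auto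
  then show ?thesis
    unfolding mpow_def mabs_def power_add abs_mult power_abs
    by (intro mult_mono power_mono) auto
qed

lemma mpow_scaleR: "mpow (s *\<^sub>R t) i = s ^ mabs i * mpow t i"
  by (simp add: mpow_def mabs_def power_mult_distrib power_add)

lemma mpow_add: "mpow t i * mpow t k = mpow t (fst i + fst k, snd i + snd k)"
  by (simp add: mpow_def power_add)

lemma continuous_on_mpow [continuous_intros]: "continuous_on S (\<lambda>t. mpow t i)"
  unfolding mpow_def by (intro continuous_intros)

lemma continuous_on_quartic [continuous_intros]: "continuous_on S (quartic x)"
  unfolding quartic_def by (intro continuous_intros)

lemma measurable_mpow [measurable]: "(\<lambda>t. mpow t i) \<in> borel_measurable borel"
  by (intro borel_measurable_continuous_onI continuous_intros)

lemma measurable_quartic [measurable]: "quartic x \<in> borel_measurable borel"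
  by (intro borel_measurable_continuous_onI continuous_intros)

lemma measurable_lebesgue_mpow [measurable]: "(\<lambda>t. mpow t i) \<in> borel_measurable lebesgue"
  by (rule measurable_completion) measurable

lemma measurable_lebesgue_quartic [measurable]: "quartic x \<in> borel_measurable lebesgue"
  by (rule measurable_completion) measurable

lemma quartic_linear: "quartic (\<lambda>i. a * x i + b * y i) t = a * quartic x t + b * quartic y t"
  by (simp add: quartic_def distrib_right sum.distrib sum_distrib_left mult.assoc)

lemma quartic_single:
  assumes "mabs i \<le> 4"
  shows "quartic (\<lambda>k. x k + (if k = i then s else 0)) t = quartic x t + s * mpow t i"
  using assms by (simp add: quartic_def distrib_right sum.distrib if_distrib[of "\<lambda>c. c * _"] cong: if_cong)

lemma tendsto_quartic:
  assumes "\<And>i. mabs i \<le> 4 \<Longrightarrow> (\<lambda>n. y n i) \<longlonglongrightarrow> q i"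
  shows "(\<lambda>n. quartic (y n) t) \<longlonglongrightarrow> quartic q t"
  unfolding quartic_def using assms by (intro tendsto_intros) auto

text \<open>
By Fubini: expanding in powers of the second variable, some coefficient is a nonzero polynomial in
the first variable, so for all but finitely many \<open>u\<close> the section at \<open>u\<close> is a nonzero polynomial in
one variable, which has finitely many zeros.
\<close>

lemma AE_quartic_nonzero:
  assumes i: "mabs i \<le> 4" "x i \<noteq> 0"
  shows "AE t in lebesgue. quartic x t \<noteq> 0"
proof -
  define y where "y m n = (if m + n \<le> 4 then x (m, n) else 0)" for m n
  have expand: "quartic x (u, v) = (\<Sum>n\<le>4. (\<Sum>m\<le>4. y m n * u ^ m) * v ^ n)" for u v
  proof -
    have "quartic x (u, v) = (\<Sum>i | mabs i \<le> 4. y (fst i) (snd i) * u ^ fst i * v ^ snd i)"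
      unfolding quartic_def by (intro sum.cong refl) (auto simp: y_def mpow_def mabs_def)
    also have "\<dots> = (\<Sum>i\<in>{..4} \<times> {..4}. y (fst i) (snd i) * u ^ fst i * v ^ snd i)"
      by (intro sum.mono_neutral_left) (auto simp: mabs_def y_def)
    also have "\<dots> = (\<Sum>m\<le>4. \<Sum>n\<le>4. y m n * u ^ m * v ^ n)"
      by (simp add: sum.cartesian_product case_prod_unfold)
    also have "\<dots> = (\<Sum>n\<le>4. (\<Sum>m\<le>4. y m n * u ^ m) * v ^ n)"
      unfolding sum_distrib_right by (rule sum.swap)
    finally show ?thesis .
  qed
  have "finite {u :: real. (\<Sum>m\<le>4. y m (snd i) * u ^ m) = 0}"
    using i by (subst polyfun_finite_roots) (auto intro!: exI[of _ "fst i"] simp: y_def mabs_def)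
  then have "AE u in lborel. u \<notin> {u :: real. (\<Sum>m\<le>4. y m (snd i) * u ^ m) = 0}"
    by (intro AE_not_in) (simp add: finite_imp_null_set_lborel)
  then have "AE u in lborel. AE v in lborel. quartic x (u, v) \<noteq> 0"
  proof eventually_elim
    case (elim u)
    then have "finite {v :: real. (\<Sum>n\<le>4. (\<Sum>m\<le>4. y m n * u ^ m) * v ^ n) = 0}"
      using i by (subst polyfun_finite_roots) (auto intro!: exI[of _ "snd i"] simp: mabs_def)
    then have "AE v in lborel. v \<notin> {v :: real. (\<Sum>n\<le>4. (\<Sum>m\<le>4. y m n * u ^ m) * v ^ n) = 0}"
      by (intro AE_not_in) (simp add: finite_imp_null_set_lborel)
    then show ?case by (simp add: expand)
  qed
  then have "AE t in lborel \<Otimes>\<^sub>M lborel. quartic x t \<noteq> 0"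
    by (rule lborel_pair.AE_pair_measure[rotated]) (unfold lborel_prod, measurable)
  then show ?thesis
    unfolding lborel_prod by (rule AE_completion)
qed

lemma not_AE_lebesgue_False: "\<not> (AE t in (lebesgue :: (real \<times> real) measure). False)"
proof
  assume "AE t in (lebesgue :: (real \<times> real) measure). False"
  then have "AE t in (lborel :: (real \<times> real) measure). False"
    by (simp only: AE_completion_iff)
  from AE_E2[OF this] show False by (simp add: emeasure_lborel_UNIV)
qed

section \<open>Decay of exponentials of negative definite quartics\<close>

text \<open>
By homogeneity and compactness of the unit circle the leading form is at most \<open>-d |t|\<^sup>4\<close> for some
\<open>d > 0\<close>, and the remaining terms are of order \<open>|t|\<^sup>3\<close>. Half of \<open>d\<close> is kept in reserve as the
constant \<open>c\<close>: it allows the coefficients, including those of the leading form, to be perturbed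
without losing integrability.
\<close>

lemma growth_of_negative_definite_quartic:
  assumes neg: "\<And>t. t \<noteq> 0 \<Longrightarrow> (\<Sum>i | mabs i = 4. x i * mpow t i) < 0"
  obtains c C where "c > 0" and "\<And>t. quartic x t + c * norm t ^ 4 \<le> C - norm t"
proof -
  define h where "h t = (\<Sum>i | mabs i = 4. x i * mpow t i)" for t
  define K where "K = (\<Sum>i | mabs i \<le> 3. \<bar>x i\<bar>)"
  have K: "0 \<le> K" unfolding K_def by (intro sum_nonneg) auto
  have hom: "h (s *\<^sub>R t) = s ^ 4 * h t" for s t
    unfolding h_def by (simp add: mpow_scaleR sum_distrib_left mult_ac)
  have "continuous_on (sphere 0 1) h"
    unfolding h_def by (intro continuous_intros)
  moreover have "((1::real), (0::real)) \<in> sphere 0 1" by (simp add: norm_prod_def)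
  ultimately obtain w where w: "w \<in> sphere 0 1" "\<And>t. t \<in> sphere 0 1 \<Longrightarrow> h t \<le> h w"
    using continuous_attains_sup[of "sphere (0 :: real \<times> real) 1" h] by auto
  define d where "d = - h w"
  have "w \<noteq> 0" using w(1) by auto
  then have d: "d > 0" using neg[of w] by (simp add: d_def h_def)
  have top: "h t \<le> - d * norm t ^ 4" for t
  proof (cases "t = 0")
    case True
    then show ?thesis using hom[of 0 0] by simp
  next
    case False
    have "h t = norm t ^ 4 * h (t /\<^sub>R norm t)"
      using hom[of "norm t" "t /\<^sub>R norm t"] False by simp
    also have "\<dots> \<le> norm t ^ 4 * h w"
      using False by (intro mult_left_mono w) auto
    finally show ?thesis by (simp add: d_def mult.commute)
  qed
  have low: "(\<Sum>i | mabs i \<le> 3. x i * mpow t i) \<le> K * (1 + norm t ^ 3)" for t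
    unfolding K_def sum_distrib_right
  proof (rule sum_mono)
    fix i :: mindex assume i: "i \<in> {i. mabs i \<le> 3}"
    have "norm t ^ mabs i \<le> 1 + norm t ^ 3" using i by (intro power_le_one_plus_power) auto
    then have "\<bar>mpow t i\<bar> \<le> 1 + norm t ^ 3" using abs_mpow_le[of t i] by linarith
    then have "\<bar>x i * mpow t i\<bar> \<le> \<bar>x i\<bar> * (1 + norm t ^ 3)"
      unfolding abs_mult by (intro mult_left_mono) auto
    then show "x i * mpow t i \<le> \<bar>x i\<bar> * (1 + norm t ^ 3)" by linarith
  qed
  define c where "c = d / 2"
  have c: "c > 0" using d by (simp add: c_def)
  \<comment> \<open>beyond \<open>U\<close> the fourth power absorbs both the cubic remainder and the linear term\<close>
  define U where "U = (K + 1) / c + 1"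
  have U: "U \<ge> 1" using c K by (simp add: U_def)
  have "quartic x t + c * norm t ^ 4 \<le> (K + K * U ^ 3 + U) - norm t" for t
  proof -
    define u where "u = norm t"
    have u: "u \<ge> 0" by (simp add: u_def)
    have split: "quartic x t = h t + (\<Sum>i | mabs i \<le> 3. x i * mpow t i)"
      unfolding quartic_def h_def
      by (subst sum.union_disjoint[symmetric]) (auto intro!: sum.cong)
    have 1: "K * u ^ 3 + u \<le> c * u ^ 4 + (K * U ^ 3 + U)"
    proof (cases "u \<le> U")
      case True
      then have "K * u ^ 3 \<le> K * U ^ 3" using u K by (intro mult_left_mono power_mono) auto
      moreover have "c * u ^ 4 \<ge> 0" using c u by simp
      ultimately show ?thesis using True by linarith
    next
      case False
      then have u1: "u \<ge> 1" using U by linarith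
      have "c * U \<ge> K + 1" using c by (simp add: U_def field_simps)
      then have "c * u \<ge> K + 1" using False c by (smt (verit) mult_left_mono)
      then have "c * u * u ^ 3 \<ge> (K + 1) * u ^ 3" using u by (intro mult_right_mono) auto
      moreover have "u ^ 3 \<ge> u ^ 1" using u1 by (intro power_increasing) auto
      moreover have "K * U ^ 3 + U \<ge> 0" using K U by simp
      moreover have "c * u * u ^ 3 = c * u ^ 4" by (simp add: power_numeral_reduce)
      ultimately show ?thesis by (simp add: distrib_right)
    qed
    have "d = 2 * c" by (simp add: c_def)
    then show ?thesis
      using 1 top[of t] low[of t] unfolding split u_def by (simp add: distrib_left)
  qed
  with c show ?thesis by (rule that)
qed

text \<open>
A common integrable majorant. Its product form makes integrability a matter of one variable, and
along each coordinate line it tends to 0, as the boundary terms of an integration by parts must.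
\<close>

definition cauchy_weight :: "real \<times> real \<Rightarrow> real"
  where "cauchy_weight t = inverse (1 + (fst t)\<^sup>2) * inverse (1 + (snd t)\<^sup>2)"

lemma integrable_cauchy_weight: "integrable lborel cauchy_weight"
proof -
  have 1: "integrable lborel (\<lambda>u :: real. inverse (1 + u\<^sup>2))"
    using integrable_inverse_1_plus_square by (simp add: set_integrable_def)
  have "integrable (lborel \<Otimes>\<^sub>M lborel) cauchy_weight"
  proof (rule lborel_pair.Fubini_integrable)
    show "cauchy_weight \<in> borel_measurable (lborel \<Otimes>\<^sub>M lborel)"
    proof -
      have "continuous_on UNIV cauchy_weight"
        unfolding cauchy_weight_def by (intro continuous_intros) (auto simp: add_nonneg_eq_0_iff)
      then have "cauchy_weight \<in> borel_measurable borel" by (rule borel_measurable_continuous_onI)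
      then show ?thesis unfolding lborel_prod by simp
    qed
    show "AE u in lborel. integrable lborel (\<lambda>v. cauchy_weight (u, v))"
      using 1 by (simp add: cauchy_weight_def)
    show "integrable lborel (\<lambda>u. LBINT v. norm (cauchy_weight (u, v)))"
      using 1 by (simp add: cauchy_weight_def abs_mult)
  qed
  then show ?thesis by (simp add: lborel_prod)
qed

text \<open>
The linear decay \<open>-|t|\<close> in the exponent beats the polynomial \<open>(1 + |t|)\<^sup>n\<close>, where
\<open>n = |j| + 4\<close> accounts for the monomial and the inverse of the weight.
\<close>

lemma exp_quartic_bound:
  assumes neg: "\<And>t. t \<noteq> 0 \<Longrightarrow> (\<Sum>i | mabs i = 4. x i * mpow t i) < 0"
  obtains c where "c > 0"
    and "\<And>j. \<exists>B. \<forall>t. \<bar>mpow t j\<bar> * exp (quartic x t + c * norm t ^ 4) \<le> B * cauchy_weight t"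
proof -
  obtain c C where c: "c > 0" and C: "\<And>t. quartic x t + c * norm t ^ 4 \<le> C - norm t"
    using growth_of_negative_definite_quartic[OF neg] by blast
  have "\<bar>mpow t j\<bar> * exp (quartic x t + c * norm t ^ 4)
      \<le> real (mabs j + 4) ^ (mabs j + 4) * exp C * cauchy_weight t" for t j
  proof -
    define u where "u = norm t"
    define n where "n = mabs j + 4"
    have u: "u \<ge> 0" by (simp add: u_def)
    have W: "inverse (cauchy_weight t) = (1 + (fst t)\<^sup>2) * (1 + (snd t)\<^sup>2)"
      by (simp add: cauchy_weight_def)
    have pos: "cauchy_weight t > 0"
      unfolding cauchy_weight_def by (intro mult_pos_pos) (auto simp: add_pos_nonneg)
    have sq: "1 + y\<^sup>2 \<le> (1 + u)\<^sup>2" if "\<bar>y\<bar> \<le> u" for y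
    proof -
      have "y\<^sup>2 \<le> u\<^sup>2" using that u by (metis abs_of_nonneg abs_le_square_iff)
      then show ?thesis using u by (simp add: power2_sum)
    qed
    have "\<bar>fst t\<bar> \<le> u" "\<bar>snd t\<bar> \<le> u"
      using norm_fst_le[of "fst t" "snd t"] norm_snd_le[of "snd t" "fst t"] by (auto simp: u_def)
    then have "inverse (cauchy_weight t) \<le> (1 + u)\<^sup>2 * (1 + u)\<^sup>2"
      unfolding W by (intro mult_mono sq) auto
    moreover have "\<bar>mpow t j\<bar> \<le> (1 + u) ^ mabs j"
      using abs_mpow_le[of t j] power_mono[of u "1 + u" "mabs j"] u unfolding u_def by linarith
    ultimately have "\<bar>mpow t j\<bar> * inverse (cauchy_weight t) \<le> (1 + u) ^ mabs j * ((1 + u)\<^sup>2 * (1 + u)\<^sup>2)"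
      using u pos by (intro mult_mono) auto
    also have "\<dots> = (1 + u) ^ n" by (simp add: n_def power_add[symmetric])
    \<comment> \<open>prepares the bound \<open>(1 + u/n)\<^sup>n \<le> e\<^sup>u\<close>\<close>
    also have "\<dots> \<le> (real n * (1 + u / real n)) ^ n"
      using u by (intro power_mono) (auto simp: n_def field_simps)
    also have "\<dots> \<le> real n ^ n * exp u"
      unfolding power_mult_distrib using u
      by (intro mult_left_mono exp_ge_one_plus_x_over_n_power_n) (auto simp: n_def)
    finally have 1: "\<bar>mpow t j\<bar> * inverse (cauchy_weight t) \<le> real n ^ n * exp u" .
    have "exp (quartic x t + c * norm t ^ 4) \<le> exp (C - u)"
      using C[of t] by (simp add: u_def)
    with 1 have "\<bar>mpow t j\<bar> * inverse (cauchy_weight t) * exp (quartic x t + c * norm t ^ 4)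
        \<le> real n ^ n * exp u * exp (C - u)"
      using pos by (intro mult_mono[of _ _ "exp _"]) auto
    also have "\<dots> = real n ^ n * exp C" by (simp add: exp_diff)
    finally show ?thesis
      using pos by (simp add: n_def field_simps)
  qed
  then show ?thesis by (intro that[OF c]) blast
qed

lemma integrable_polynomial_exp_quartic:
  assumes neg: "\<And>t. t \<noteq> 0 \<Longrightarrow> (\<Sum>i | mabs i = 4. x i * mpow t i) < 0"
  obtains c where "c > 0"
    and "\<And>j s. s \<le> c \<Longrightarrow> integrable lborel (\<lambda>t. mpow t j * exp (quartic x t + s * norm t ^ 4))"
proof -
  obtain c where c: "c > 0"
    and bd: "\<And>j. \<exists>B. \<forall>t. \<bar>mpow t j\<bar> * exp (quartic x t + c * norm t ^ 4) \<le> B * cauchy_weight t"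
    using exp_quartic_bound[OF neg] by blast
  show ?thesis
  proof (rule that[OF c])
    fix j s assume s: "s \<le> c"
    obtain B where B: "\<And>t. \<bar>mpow t j\<bar> * exp (quartic x t + c * norm t ^ 4) \<le> B * cauchy_weight t"
      using bd by blast
    show "integrable lborel (\<lambda>t. mpow t j * exp (quartic x t + s * norm t ^ 4))"
    proof (rule Bochner_Integration.integrable_bound)
      show "integrable lborel (\<lambda>t. B * cauchy_weight t)"
        using integrable_cauchy_weight by simp
      show "AE t in lborel. norm (mpow t j * exp (quartic x t + s * norm t ^ 4)) \<le> norm (B * cauchy_weight t)"
      proof (rule AE_I2)
        fix t
        have "\<bar>mpow t j\<bar> * exp (quartic x t + s * norm t ^ 4) \<le> \<bar>mpow t j\<bar> * exp (quartic x t + c * norm t ^ 4)"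
          using s by (intro mult_left_mono) (auto intro: mult_right_mono)
        then show "norm (mpow t j * exp (quartic x t + s * norm t ^ 4)) \<le> norm (B * cauchy_weight t)"
          using B[of t] abs_ge_self[of "B * cauchy_weight t"] by (simp only: real_norm_def abs_mult[of "mpow t j"] abs_exp_cancel)
      qed
    qed measurable
  qed
qed

lemma integrable_moment:
  assumes neg: "\<And>t. t \<noteq> 0 \<Longrightarrow> (\<Sum>i | mabs i = 4. x i * mpow t i) < 0"
  shows "integrable lborel (\<lambda>t. mpow t j * exp (quartic x t))"
proof -
  obtain c where "c > 0"
    and "\<And>j s. s \<le> c \<Longrightarrow> integrable lborel (\<lambda>t. mpow t j * exp (quartic x t + s * norm t ^ 4))"
    using integrable_polynomial_exp_quartic[OF neg] by blast
  from this(2)[of 0 j] this(1) show ?thesis by simp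
qed

section \<open>Integration by parts in the plane\<close>

text \<open>
The fundamental theorem of calculus on the line if the derivative is integrable; otherwise the
Bochner integral is 0 by convention. Fubini's theorem produces sections of both kinds.
\<close>

lemma integral_derivative_eq_0:
  fixes F f :: "real \<Rightarrow> real"
  assumes deriv: "\<And>u. (F has_real_derivative f u) (at u)" and cont: "continuous_on UNIV f"
    and lim: "(F \<longlongrightarrow> 0) at_top" "(F \<longlongrightarrow> 0) at_bot"
  shows "(LBINT u. f u) = 0"
proof (cases "integrable lborel f")
  case True
  have "(LBINT u=-\<infinity>..\<infinity>. f u) = 0 - 0"
  proof (rule interval_integral_FTC_integrable)
    show "(F has_vector_derivative f u) (at u)" for u
      using deriv[of u] by (simp add: has_real_derivative_iff_has_vector_derivative)
    show "isCont f u" for u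
      using cont by (simp add: continuous_on_eq_continuous_at)
    show "set_integrable lborel (einterval (- \<infinity>) \<infinity>) f"
      using True by (simp add: set_integrable_def)
    show "((F \<circ> real_of_ereal) \<longlongrightarrow> 0) (at_right (- \<infinity>))" "((F \<circ> real_of_ereal) \<longlongrightarrow> 0) (at_left \<infinity>)"
      using lim by (simp_all add: ereal_tendsto_simps)
  qed simp
  then show ?thesis
    by (simp add: interval_lebesgue_integral_def set_lebesgue_integral_def)
qed (rule not_integrable_integral_eq)

text \<open>
The partial derivatives are indexed by the monomials of the result rather than by those of the
quartic. This avoids negative exponents and is the indexing by \<open>\<kappa>\<close> in the definition of the
coefficients \<open>c\<close>.
\<close>

lemma partial_quartic:
  "((\<lambda>u. quartic x (u, v)) has_real_derivative
    (\<Sum>k | mabs k \<le> 3. real (fst k + 1) * x (fst k + 1, snd k) * mpow (u, v) k)) (at u)"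
  "((\<lambda>v. quartic x (u, v)) has_real_derivative
    (\<Sum>k | mabs k \<le> 3. real (snd k + 1) * x (fst k, snd k + 1) * mpow (u, v) k)) (at v)"
proof -
  have "((\<lambda>u. quartic x (u, v)) has_real_derivative
    (\<Sum>i | mabs i \<le> 4. x i * (real (fst i) * u ^ (fst i - 1) * v ^ snd i))) (at u)"
    unfolding quartic_def mpow_def by (auto intro!: derivative_eq_intros sum.cong)
  also have "(\<Sum>i | mabs i \<le> 4. x i * (real (fst i) * u ^ (fst i - 1) * v ^ snd i))
      = (\<Sum>i\<in>{i \<in> {i. mabs i \<le> 4}. 0 < fst i}. x i * (real (fst i) * u ^ (fst i - 1) * v ^ snd i))"
    by (intro sum.mono_neutral_right finite_mabs_le) auto
  also have "\<dots> = (\<Sum>k | mabs k \<le> 3. real (fst k + 1) * x (fst k + 1, snd k) * mpow (u, v) k)"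
    by (rule sum.reindex_bij_witness[where i="\<lambda>k. (fst k + 1, snd k)" and j="\<lambda>i. (fst i - 1, snd i)"])
      (auto simp: mabs_def mpow_def)
  finally show "((\<lambda>u. quartic x (u, v)) has_real_derivative
    (\<Sum>k | mabs k \<le> 3. real (fst k + 1) * x (fst k + 1, snd k) * mpow (u, v) k)) (at u)" .
next
  have "((\<lambda>v. quartic x (u, v)) has_real_derivative
    (\<Sum>i | mabs i \<le> 4. x i * (u ^ fst i * (real (snd i) * v ^ (snd i - 1))))) (at v)"
    unfolding quartic_def mpow_def by (auto intro!: derivative_eq_intros sum.cong)
  also have "(\<Sum>i | mabs i \<le> 4. x i * (u ^ fst i * (real (snd i) * v ^ (snd i - 1))))
      = (\<Sum>i\<in>{i \<in> {i. mabs i \<le> 4}. 0 < snd i}. x i * (u ^ fst i * (real (snd i) * v ^ (snd i - 1))))"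
    by (intro sum.mono_neutral_right finite_mabs_le) auto
  also have "\<dots> = (\<Sum>k | mabs k \<le> 3. real (snd k + 1) * x (fst k, snd k + 1) * mpow (u, v) k)"
    by (rule sum.reindex_bij_witness[where i="\<lambda>k. (fst k, snd k + 1)" and j="\<lambda>i. (fst i, snd i - 1)"])
      (auto simp: mabs_def mpow_def)
  finally show "((\<lambda>v. quartic x (u, v)) has_real_derivative
    (\<Sum>k | mabs k \<le> 3. real (snd k + 1) * x (fst k, snd k + 1) * mpow (u, v) k)) (at v)" .
qed

lemma tendsto_0_cauchy_bound:
  fixes F :: "real \<Rightarrow> real"
  assumes "\<And>u. \<bar>F u\<bar> \<le> B * inverse (1 + u\<^sup>2)"
  shows "(F \<longlongrightarrow> 0) at_top" "(F \<longlongrightarrow> 0) at_bot"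
proof -
  have top: "((\<lambda>u :: real. B * inverse (1 + u\<^sup>2)) \<longlongrightarrow> 0) at_top"
    and bot: "((\<lambda>u :: real. B * inverse (1 + u\<^sup>2)) \<longlongrightarrow> 0) at_bot"
    by real_asymp+
  show "(F \<longlongrightarrow> 0) at_top"
    by (rule Lim_null_comparison[OF _ top]) (use assms in auto)
  show "(F \<longlongrightarrow> 0) at_bot"
    by (rule Lim_null_comparison[OF _ bot]) (use assms in auto)
qed

text \<open>
The integrals of \<open>\<partial>\<^sub>1(t\<^sup>i e\<^sup>q)\<close> and \<open>\<partial>\<^sub>2(t\<^sup>i e\<^sup>q)\<close> vanish. In each case the variable of
differentiation is integrated first. The truncated exponent \<open>fst i - 1\<close> is harmless, since it is
multiplied by 0 when \<open>fst i = 0\<close>.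
\<close>

lemma integration_by_parts:
  assumes neg: "\<And>t. t \<noteq> 0 \<Longrightarrow> (\<Sum>i | mabs i = 4. x i * mpow t i) < 0"
  defines "M \<equiv> \<lambda>i. LBINT t. mpow t i * exp (quartic x t)"
  shows "real (fst i) * M (fst i - 1, snd i)
        + (\<Sum>k | mabs k \<le> 3. real (fst k + 1) * x (fst k + 1, snd k) * M (fst i + fst k, snd i + snd k)) = 0"
    and "real (snd i) * M (fst i, snd i - 1)
        + (\<Sum>k | mabs k \<le> 3. real (snd k + 1) * x (fst k, snd k + 1) * M (fst i + fst k, snd i + snd k)) = 0"
proof -
  let ?e = "\<lambda>t. exp (quartic x t)"
  have int: "integrable lborel (\<lambda>t. mpow t j * ?e t)" for j
    by (rule integrable_moment[OF neg])
  \<comment> \<open>makes the boundary terms at infinity vanish\<close>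
  obtain B where B: "\<And>t. \<bar>mpow t i\<bar> * ?e t \<le> B * cauchy_weight t"
  proof -
    obtain c where c: "c > 0"
      and bd: "\<And>j. \<exists>B. \<forall>t. \<bar>mpow t j\<bar> * exp (quartic x t + c * norm t ^ 4) \<le> B * cauchy_weight t"
      using exp_quartic_bound[OF neg] by blast
    then obtain B where B: "\<And>t. \<bar>mpow t i\<bar> * exp (quartic x t + c * norm t ^ 4) \<le> B * cauchy_weight t"
      by blast
    show ?thesis
    proof (rule that)
      fix t
      have "\<bar>mpow t i\<bar> * ?e t \<le> \<bar>mpow t i\<bar> * exp (quartic x t + c * norm t ^ 4)"
        using c by (intro mult_left_mono) auto
      then show "\<bar>mpow t i\<bar> * ?e t \<le> B * cauchy_weight t" using B[of t] by linarith
    qed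
  qed
  have le: "\<bar>mpow (u, v) i * ?e (u, v)\<bar> \<le> (B * inverse (1 + v\<^sup>2)) * inverse (1 + u\<^sup>2)"
           "\<bar>mpow (u, v) i * ?e (u, v)\<bar> \<le> (B * inverse (1 + u\<^sup>2)) * inverse (1 + v\<^sup>2)" for u v
    using B[of "(u, v)"] by (simp_all add: abs_mult cauchy_weight_def mult_ac)

  define f1 where "f1 t = real (fst i) * (mpow t (fst i - 1, snd i) * ?e t)
     + (\<Sum>k | mabs k \<le> 3. real (fst k + 1) * x (fst k + 1, snd k) * (mpow t (fst i + fst k, snd i + snd k) * ?e t))" for t
  have f1_cont: "continuous_on S f1" for S
    unfolding f1_def by (intro continuous_intros)
  have f1_int: "integrable (lborel \<Otimes>\<^sub>M lborel) (\<lambda>(u, v). f1 (u, v))"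
    unfolding lborel_prod f1_def case_prod_unfold prod.collapse
    by (intro Bochner_Integration.integrable_add integrable_mult_right Bochner_Integration.integrable_sum int)
  have "(LBINT t. f1 t) = (LBINT v. LBINT u. f1 (u, v))"
    using lborel_pair.integral_snd[OF f1_int] by (simp add: lborel_prod)
  also have "\<dots> = integral\<^sup>L (lborel :: real measure) (\<lambda>_. 0)"
  proof (rule Bochner_Integration.integral_cong[OF refl])
    fix v :: real
    show "(LBINT u. f1 (u, v)) = 0"
    proof (rule integral_derivative_eq_0)
      fix u
      have "((\<lambda>u. u ^ fst i * v ^ snd i * ?e (u, v)) has_real_derivative
         real (fst i) * u ^ (fst i - 1) * v ^ snd i * ?e (u, v)
         + ?e (u, v) * (\<Sum>k | mabs k \<le> 3. real (fst k + 1) * x (fst k + 1, snd k) * mpow (u, v) k) * (u ^ fst i * v ^ snd i)) (at u)"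
        by (rule derivative_eq_intros partial_quartic refl | simp)+
      also have "real (fst i) * u ^ (fst i - 1) * v ^ snd i * ?e (u, v)
         + ?e (u, v) * (\<Sum>k | mabs k \<le> 3. real (fst k + 1) * x (fst k + 1, snd k) * mpow (u, v) k) * (u ^ fst i * v ^ snd i)
         = f1 (u, v)"
        unfolding f1_def sum_distrib_left sum_distrib_right mpow_add[symmetric]
        by (simp add: mpow_def mult_ac)
      finally show "((\<lambda>u. mpow (u, v) i * ?e (u, v)) has_real_derivative f1 (u, v)) (at u)"
        by (simp add: mpow_def)
    next
      show "continuous_on UNIV (\<lambda>u. f1 (u, v))"
        by (rule continuous_on_compose2[OF f1_cont[of UNIV]]) (auto intro!: continuous_intros)
      show "((\<lambda>u. mpow (u, v) i * ?e (u, v)) \<longlongrightarrow> 0) at_top" "((\<lambda>u. mpow (u, v) i * ?e (u, v)) \<longlongrightarrow> 0) at_bot"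
        by (rule tendsto_0_cauchy_bound, rule le)+
    qed
  qed
  finally have "(LBINT t. f1 t) = 0" by simp
  then show "real (fst i) * M (fst i - 1, snd i)
        + (\<Sum>k | mabs k \<le> 3. real (fst k + 1) * x (fst k + 1, snd k) * M (fst i + fst k, snd i + snd k)) = 0"
    unfolding f1_def M_def
    by (simp add: int Bochner_Integration.integral_sum)

  define f2 where "f2 t = real (snd i) * (mpow t (fst i, snd i - 1) * ?e t)
     + (\<Sum>k | mabs k \<le> 3. real (snd k + 1) * x (fst k, snd k + 1) * (mpow t (fst i + fst k, snd i + snd k) * ?e t))" for t
  have f2_cont: "continuous_on S f2" for S
    unfolding f2_def by (intro continuous_intros)
  have f2_int: "integrable (lborel \<Otimes>\<^sub>M lborel) (\<lambda>(u, v). f2 (u, v))"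
    unfolding lborel_prod f2_def case_prod_unfold prod.collapse
    by (intro Bochner_Integration.integrable_add integrable_mult_right Bochner_Integration.integrable_sum int)
  have "(LBINT t. f2 t) = (LBINT u. LBINT v. f2 (u, v))"
    using lborel_pair.integral_fst[OF f2_int] by (simp add: lborel_prod)
  also have "\<dots> = integral\<^sup>L (lborel :: real measure) (\<lambda>_. 0)"
  proof (rule Bochner_Integration.integral_cong[OF refl])
    fix u :: real
    show "(LBINT v. f2 (u, v)) = 0"
    proof (rule integral_derivative_eq_0)
      fix v
      have "((\<lambda>v. v ^ snd i * u ^ fst i * ?e (u, v)) has_real_derivative
         real (snd i) * v ^ (snd i - 1) * u ^ fst i * ?e (u, v)
         + ?e (u, v) * (\<Sum>k | mabs k \<le> 3. real (snd k + 1) * x (fst k, snd k + 1) * mpow (u, v) k) * (v ^ snd i * u ^ fst i)) (at v)"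
        by (rule derivative_eq_intros partial_quartic refl | simp)+
      also have "real (snd i) * v ^ (snd i - 1) * u ^ fst i * ?e (u, v)
         + ?e (u, v) * (\<Sum>k | mabs k \<le> 3. real (snd k + 1) * x (fst k, snd k + 1) * mpow (u, v) k) * (v ^ snd i * u ^ fst i)
         = f2 (u, v)"
        unfolding f2_def sum_distrib_left sum_distrib_right mpow_add[symmetric]
        by (simp add: mpow_def mult_ac)
      finally show "((\<lambda>v. mpow (u, v) i * ?e (u, v)) has_real_derivative f2 (u, v)) (at v)"
        by (simp add: mpow_def mult_ac)
    next
      show "continuous_on UNIV (\<lambda>v. f2 (u, v))"
        by (rule continuous_on_compose2[OF f2_cont[of UNIV]]) (auto intro!: continuous_intros)
      show "((\<lambda>v. mpow (u, v) i * ?e (u, v)) \<longlongrightarrow> 0) at_top" "((\<lambda>v. mpow (u, v) i * ?e (u, v)) \<longlongrightarrow> 0) at_bot"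
        by (rule tendsto_0_cauchy_bound, rule le)+
    qed
  qed
  finally have "(LBINT t. f2 t) = 0" by simp
  then show "real (snd i) * M (fst i, snd i - 1)
        + (\<Sum>k | mabs k \<le> 3. real (snd k + 1) * x (fst k, snd k + 1) * M (fst i + fst k, snd i + snd k)) = 0"
    unfolding f2_def M_def
    by (simp add: int Bochner_Integration.integral_sum)
qed

section \<open>Cancellation of the top degree\<close>

lemma exhaust_6:
  fixes i :: 6
  shows "i = 1 \<or> i = 2 \<or> i = 3 \<or> i = 4 \<or> i = 5 \<or> i = 6"
proof (induct i)
  case (of_int z)
  then have "0 \<le> z" "z < 6" by simp_all
  then have "z = 0 \<or> z = 1 \<or> z = 2 \<or> z = 3 \<or> z = 4 \<or> z = 5" by linarith
  then show ?case by auto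
qed

lemma UNIV_6: "(UNIV :: 6 set) = {1, 2, 3, 4, 5, 6}"
  using exhaust_6 by auto

lemma sum_6: "sum f (UNIV :: 6 set) = f 1 + f 2 + f 3 + f 4 + f 5 + f 6"
  unfolding UNIV_6 by (simp add: ac_simps)

lemma vector_6:
  "(vector [a, b, c, d, e, f] :: 'a::zero^6) $ 1 = a"
  "(vector [a, b, c, d, e, f] :: 'a::zero^6) $ 2 = b"
  "(vector [a, b, c, d, e, f] :: 'a::zero^6) $ 3 = c"
  "(vector [a, b, c, d, e, f] :: 'a::zero^6) $ 4 = d"
  "(vector [a, b, c, d, e, f] :: 'a::zero^6) $ 5 = e"
  "(vector [a, b, c, d, e, f] :: 'a::zero^6) $ 6 = f"
  unfolding vector_def by simp_all

lemma A_times_sol: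
  assumes "det (A x) \<noteq> 0"
  shows "A x *v sol x j = rhs x j"
proof -
  obtain B where B: "A x ** B = mat 1" "B ** A x = mat 1"
    using assms by (auto simp: invertible_det_nz[symmetric] invertible_def)
  have "\<exists>!v. A x *v v = rhs x j"
  proof
    show "A x *v (B *v rhs x j) = rhs x j"
      by (simp add: matrix_vector_mul_assoc B)
  next
    fix v assume "A x *v v = rhs x j"
    then show "v = B *v rhs x j"
      by (metis B(2) matrix_vector_mul_assoc matrix_vector_mul_lid)
  qed
  then show ?thesis
    unfolding sol_def by (rule theI')
qed

text \<open>
The linear system written out. The unknowns 4 to 6 are the negatives of the last three values of
\<open>\<alpha>\<close>, whence the plus signs throughout.
\<close>

lemma sol_rows:
  fixes x :: "mindex \<Rightarrow> real" and j :: mindex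
  assumes "det (A x) \<noteq> 0"
  defines "s \<equiv> sol x j"
  shows
    "4*x(4,0)* s$1 + x(3,1)* s$4 = rhs x j $ 1"
    "3*x(3,1)* s$1 + 4*x(4,0)* s$2 + 2*x(2,2)* s$4 + x(3,1)* s$5 = rhs x j $ 2"
    "2*x(2,2)* s$1 + 3*x(3,1)* s$2 + 4*x(4,0)* s$3 + 3*x(1,3)* s$4 + 2*x(2,2)* s$5 + x(3,1)* s$6 = rhs x j $ 3"
    "x(1,3)* s$1 + 2*x(2,2)* s$2 + 3*x(3,1)* s$3 + 4*x(0,4)* s$4 + 3*x(1,3)* s$5 + 2*x(2,2)* s$6 = rhs x j $ 4"
    "x(1,3)* s$2 + 2*x(2,2)* s$3 + 4*x(0,4)* s$5 + 3*x(1,3)* s$6 = rhs x j $ 5"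
    "x(1,3)* s$3 + 4*x(0,4)* s$6 = rhs x j $ 6"
  unfolding A_times_sol[OF assms(1), of j, symmetric] s_def
  by (simp_all add: matrix_vector_mult_def sum_6 A_def vector_6)

text \<open>
Of the sum that defines \<open>\<beta>\<^sub>p\<close> only the three preceding values survive, because \<open>\<partial>\<^sub>1h\<close> has four
coefficients. Integer indices let the equation hold verbatim for \<open>p < 3\<close> as well.
\<close>

lemma beta_low_step:
  assumes "x (4,0) \<noteq> 0" and "0 \<le> p" and "p \<le> int (mabs j) - 6"
  shows "4*x(4,0) * beta_low x j p + 3*x(3,1) * beta_low x j (p-1)
    + 2*x(2,2) * beta_low x j (p-2) + x(1,3) * beta_low x j (p-3) = delta j (nat p)"
proof -
  define q where "q = nat p"
  have p: "p = int q" using assms by (simp add: q_def)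
  have bl: "beta_low x j (int n) = beta_rec x j n" if "n \<le> q" for n
    using that assms p by (simp add: beta_low_def)
  have bl_neg: "beta_low x j n = 0" if "n < 0" for n
    using that by (simp add: beta_low_def)
  \<comment> \<open>the terms of the sum, indexed by the distance \<open>s\<close> from \<open>p\<close>\<close>
  define h where "h s = of_int (4 - int s) * ext x (4 - int s) (int s) * beta_low x j (int q - int s)" for s
  \<comment> \<open>for \<open>s = 4\<close> the factor \<open>4 - s\<close> vanishes, beyond that the first index of \<open>x\<close> is negative\<close>
  have h0: "h s = 0" if "s \<ge> 4" for s
  proof (cases "s = 4")
    case False
    then show ?thesis using that by (simp add: h_def ext_def)
  qed (simp add: h_def)
  have "(\<Sum>p\<in>{..<q}. of_int (4 + int p - int q) * ext x (4 + int p - int q) (int q - int p)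
          * beta_rec x j p) = (\<Sum>s\<in>{1..q}. h s)"
    by (rule sum.reindex_bij_witness[where i="\<lambda>s. q - s" and j="\<lambda>p. q - p"])
      (auto simp: h_def bl of_nat_diff algebra_simps)
  also have "\<dots> = (\<Sum>s\<in>{1..q} \<union> {1..3}. h s)"
  proof (rule sum.mono_neutral_left)
    show "\<forall>s\<in>({1..q} \<union> {1..3}) - {1..q}. h s = 0"
      by (auto simp: h_def bl_neg)
  qed auto
  also have "\<dots> = (\<Sum>s\<in>{1..3}. h s)"
  proof (rule sum.mono_neutral_right)
    show "\<forall>s\<in>({1..q} \<union> {1..3}) - {1..3}. h s = 0"
      by (auto intro: h0)
  qed auto
  also have "\<dots> = h 1 + h 2 + h 3"
    by (simp add: numeral_3_eq_3 numeral_2_eq_2)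
  also have "\<dots> = 3*x(3,1) * beta_low x j (p-1) + 2*x(2,2) * beta_low x j (p-2) + x(1,3) * beta_low x j (p-3)"
    by (simp add: h_def ext_def p)
  finally have S: "(\<Sum>p\<in>{..<q}. of_int (4 + int p - int q) * ext x (4 + int p - int q) (int q - int p)
          * beta_rec x j p) = \<dots>" .
  have "beta_low x j p = beta_rec x j q" using bl[of q] p by simp
  also have "\<dots> = (- (3*x(3,1) * beta_low x j (p-1) + 2*x(2,2) * beta_low x j (p-2) + x(1,3) * beta_low x j (p-3))
     + delta j q) / (4 * x (4,0))"
    by (subst beta_rec.simps) (simp only: S)
  finally show ?thesis using assms(1) by (simp add: field_simps p)
qed

text \<open>
The left-hand side is the coefficient of \<open>t\<^sup>m\<close>, \<open>|m| = |j|\<close>, in \<open>a \<partial>\<^sub>2h - b \<partial>\<^sub>1h\<close>, where \<open>h\<close>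
is the leading form of the quartic. With \<open>q = snd m\<close> and \<open>l = |j| - 1\<close> it involves \<open>\<alpha>\<close> and \<open>\<beta>\<close>
at \<open>q, q - 1, q - 2, q - 3\<close> only. For \<open>q \<le> l - 5\<close> all these \<open>\<alpha>\<close> are zero and the equation is the
recursion for \<open>\<beta>\<close>; the six values from \<open>l - 4\<close> to \<open>l + 1\<close> give the six rows of the linear system.
\<close>

lemma top_degree_coefficient:
  assumes x40: "x (4,0) \<noteq> 0" and det: "det (A x) \<noteq> 0" and j: "5 \<le> mabs j" and m: "mabs m = mabs j"
  shows "(\<Sum>k\<in>I_set (mabs j - 1) m.
        real (snd k + 1) * x (fst k, snd k + 1) * a_coeff x j (fst m - fst k, snd m - snd k)
      - real (fst k + 1) * x (fst k + 1, snd k) * b_coeff x j (fst m - fst k, snd m - snd k))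
    = - (if m = j then 1 else 0)"
proof -
  define l where "l = mabs j - 1"
  define q where "q = snd m"
  have l: "4 \<le> l" "mabs j = l + 1" using j by (auto simp: l_def)
  have q: "q \<le> l + 1" "fst m = l + 1 - q" using m l by (auto simp: q_def mabs_def)
  \<comment> \<open>extension by 0 to negative indices, to treat \<open>q < 3\<close> uniformly\<close>
  define al where "al p = (if p < 0 then 0 else alpha x j (nat p))" for p :: int
  define be where "be p = (if p < 0 then 0 else beta x j (nat p))" for p :: int
  define s where "s = sol x j"
  have al: "al p = (if p = int l - 4 then - s$4 else if p = int l - 3 then - s$5
      else if p = int l - 2 then - s$6 else 0)" for p
  proof (cases "p < 0")
    case True
    then show ?thesis using l by (simp add: al_def)
  next
    case False
    then obtain n where n: "p = int n" by (metis nonneg_int_cases not_less)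
    have "n = l - 4 \<longleftrightarrow> int n = int l - 4" "n = l - 3 \<longleftrightarrow> int n = int l - 3" "n = l - 2 \<longleftrightarrow> int n = int l - 2"
      using l by linarith+
    then show ?thesis
      unfolding al_def alpha_def Let_def l_def[symmetric] s_def[symmetric] n by simp
  qed
  have be: "be p = (if p = int l - 4 then s$1 else if p = int l - 3 then s$2
      else if p = int l - 2 then s$3 else beta_low x j p)" for p
  proof (cases "p < 0")
    case True
    then show ?thesis using l by (simp add: be_def beta_low_def)
  next
    case False
    then obtain n where n: "p = int n" by (metis nonneg_int_cases not_less)
    have "n = l - 4 \<longleftrightarrow> int n = int l - 4" "n = l - 3 \<longleftrightarrow> int n = int l - 3" "n = l - 2 \<longleftrightarrow> int n = int l - 2"
      using l by linarith+
    then show ?thesis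
      unfolding be_def beta_def Let_def l_def[symmetric] s_def[symmetric] n by simp
  qed
  have bl0: "beta_low x j p = 0" if "p > int l - 5" for p
    using that l by (simp add: beta_low_def)
  define F where "F i = real (i+1) * x (3 - i, i + 1) * al (int q - int i)
      - real (4 - i) * x (4 - i, i) * be (int q - int i)" for i
  \<comment> \<open>\<open>\<kappa>\<close> runs through the exponents \<open>(3 - i, i)\<close> of degree 3\<close>
  have I: "I_set l m = (\<lambda>i. (3 - i, i)) ` {i. i \<le> 3 \<and> i \<le> q \<and> q - i \<le> l - 2}" (is "?L = ?R")
  proof
    show "?L \<subseteq> ?R"
    proof
      fix k assume k: "k \<in> ?L"
      then have "k = (3 - snd k, snd k)" "snd k \<le> 3" "snd k \<le> q" "q - snd k \<le> l - 2"
        using m l q by (auto simp: I_set_def mabs_def prod_eq_iff q_def)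
      then show "k \<in> ?R" by blast
    qed
    show "?R \<subseteq> ?L"
      using m l q by (auto simp: I_set_def mabs_def q_def)
  qed
  have "(\<Sum>k\<in>I_set (mabs j - 1) m.
        real (snd k + 1) * x (fst k, snd k + 1) * a_coeff x j (fst m - fst k, snd m - snd k)
      - real (fst k + 1) * x (fst k + 1, snd k) * b_coeff x j (fst m - fst k, snd m - snd k))
    = (\<Sum>i | i \<le> 3 \<and> i \<le> q \<and> q - i \<le> l - 2. F i)"
    unfolding l_def[symmetric] I
  proof (subst sum.reindex, (simp add: inj_on_def; fail), rule sum.cong, (rule refl), unfold comp_def fst_conv snd_conv)
    fix i assume i: "i \<in> {i. i \<le> 3 \<and> i \<le> q \<and> q - i \<le> l - 2}"
    then have 1: "mabs (fst m - (3 - i), snd m - i) = mabs j - 3"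
      using l q by (auto simp: mabs_def q_def)
    have 2: "nat (int q - int i) = snd m - i" "\<not> int q - int i < 0" "Suc (3 - i) = 4 - i"
      using i by (auto simp: q_def)
    show "real (i + 1) * x (3 - i, i + 1) * a_coeff x j (fst m - (3 - i), snd m - i) -
       real (3 - i + 1) * x (3 - i + 1, i) * b_coeff x j (fst m - (3 - i), snd m - i) = F i"
      unfolding a_coeff_def b_coeff_def F_def al_def be_def using 1 2 by simp
  qed
  also have "\<dots> = (\<Sum>i\<in>{0..3}. F i)"
  proof (rule sum.mono_neutral_left)
    show "\<forall>i\<in>{0..3} - {i. i \<le> 3 \<and> i \<le> q \<and> q - i \<le> l - 2}. F i = 0"
    proof
      fix i assume i: "i \<in> {0..3} - {i. i \<le> 3 \<and> i \<le> q \<and> q - i \<le> l - 2}"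
      then consider "int q - int i < 0" | "int q - int i > int l - 2" using l by force
      then show "F i = 0"
      proof cases
        case 1 then show ?thesis by (simp add: F_def al_def be_def)
      next
        case 2 then show ?thesis by (simp add: F_def al be bl0)
      qed
    qed
  qed auto
  also have "\<dots> = F 0 + F 1 + F 2 + F 3"
    by (simp add: numeral_3_eq_3 numeral_2_eq_2)
  also have "\<dots> = x(3,1) * al (int q) + 2*x(2,2) * al (int q - 1) + 3*x(1,3) * al (int q - 2) + 4*x(0,4) * al (int q - 3)
     - (4*x(4,0) * be (int q) + 3*x(3,1) * be (int q - 1) + 2*x(2,2) * be (int q - 2) + x(1,3) * be (int q - 3))"
    by (simp add: F_def numeral_2_eq_2[symmetric])
  also have "\<dots> = - delta j q"
  proof -
    consider "int q \<le> int l - 5" | "int q = int l - 4" | "int q = int l - 3" | "int q = int l - 2"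
      | "int q = int l - 1" | "int q = int l" | "int q = int l + 1"
      using q l by linarith
    then show ?thesis
    proof cases
      case 1
      then show ?thesis
        using beta_low_step[of x "int q" j] x40 l by (simp add: al be)
    next
      case 2
      then have "q = l - 4" using l by simp
      then show ?thesis
        using sol_rows(1)[OF det, of j] 2 unfolding rhs_def Let_def vector_6 l_def[symmetric] s_def[symmetric]
        by (simp add: al be)
    next
      case 3
      then have "q = l - 3" using l by simp
      then show ?thesis
        using sol_rows(2)[OF det, of j] 3 unfolding rhs_def Let_def vector_6 l_def[symmetric] s_def[symmetric]
        by (simp add: al be)
    next
      case 4
      then have "q = l - 2" using l by simp
      then show ?thesis
        using sol_rows(3)[OF det, of j] 4 unfolding rhs_def Let_def vector_6 l_def[symmetric] s_def[symmetric]
        by (simp add: al be)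
    next
      case 5
      then have "q = l - 1" using l by simp
      then show ?thesis
        using sol_rows(4)[OF det, of j] 5 unfolding rhs_def Let_def vector_6 l_def[symmetric] s_def[symmetric]
        by (simp add: al be bl0)
    next
      case 6
      then have "q = l" using l by simp
      then show ?thesis
        using sol_rows(5)[OF det, of j] 6 unfolding rhs_def Let_def vector_6 l_def[symmetric] s_def[symmetric]
        by (simp add: al be bl0)
    next
      case 7
      then have "q = l + 1" using l by simp
      then show ?thesis
        using sol_rows(6)[OF det, of j] 7 unfolding rhs_def Let_def vector_6 l_def[symmetric] s_def[symmetric]
        by (simp add: al be bl0 \<open>q = l + 1\<close>)
    qed
  qed
  also have "delta j q = (if m = j then 1 else 0)"
    using m by (auto simp: delta_def q_def mabs_def prod_eq_iff)
  finally show ?thesis .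
qed

section \<open>Reduction of higher moments to moments of order at most four\<close>

text \<open>
Adding the integration by parts formulas for the monomials \<open>t\<^sup>i\<close> of degree \<open>|j| - 3\<close> with weights
\<open>a\<^sub>i\<close> and \<open>-b\<^sub>i\<close>, and collecting the result by monomials \<open>t\<^sup>m\<close>, one obtains 0 as a combination of
the moments \<open>M\<^sub>m\<close> with \<open>|m| \<le> |j|\<close>. The terms of order \<open>|j|\<close> add up to \<open>-M\<^sub>j\<close>. This is
linear algebra, valid for every family \<open>M\<close> that satisfies these formulas.
\<close>

lemma moment_reduction:
  fixes M x :: "mindex \<Rightarrow> real"
  assumes x40: "x (4,0) \<noteq> 0" and det: "det (A x) \<noteq> 0" and j: "5 \<le> mabs j"
    and ibp1: "\<And>i. real (fst i) * M (fst i - 1, snd i)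
        + (\<Sum>k | mabs k \<le> 3. real (fst k + 1) * x (fst k + 1, snd k) * M (fst i + fst k, snd i + snd k)) = 0"
    and ibp2: "\<And>i. real (snd i) * M (fst i, snd i - 1)
        + (\<Sum>k | mabs k \<le> 3. real (snd k + 1) * x (fst k, snd k + 1) * M (fst i + fst k, snd i + snd k)) = 0"
  shows "M j = (\<Sum>m\<in>{m. mabs m < mabs j}. c_coeff x j m * M m)"
proof -
  define l where "l = mabs j - 1"
  have l: "4 \<le> l" "mabs j = l + 1" "mabs j - 3 = l - 2" using j by (auto simp: l_def)
  define D where "D = {i :: mindex. mabs i = l - 2}"
  define a where "a = a_coeff x j"
  define b where "b = b_coeff x j"
  define h where "h k m = real (snd k + 1) * x (fst k, snd k + 1) * a (fst m - fst k, snd m - snd k)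
      - real (fst k + 1) * x (fst k + 1, snd k) * b (fst m - fst k, snd m - snd k)" for k m :: mindex
  have fin: "finite D" unfolding D_def by simp
  \<comment> \<open>derivatives falling on \<open>a\<close> and \<open>b\<close>, collected by \<open>m = i - e\<^sub>2\<close> and \<open>m = i - e\<^sub>1\<close>\<close>
  have lower: "(\<Sum>i\<in>D. a i * (real (snd i) * M (fst i, snd i - 1)) - b i * (real (fst i) * M (fst i - 1, snd i)))
      = (\<Sum>m | mabs m \<le> l. d_coeff x j m * M m)"
  proof -
    have a: "(\<Sum>i\<in>D. a i * (real (snd i) * M (fst i, snd i - 1)))
        = (\<Sum>m | mabs m = l - 3. real (snd m + 1) * a (fst m, snd m + 1) * M m)"
    proof -
      have "(\<Sum>i\<in>D. a i * (real (snd i) * M (fst i, snd i - 1)))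
          = (\<Sum>i\<in>{i \<in> D. 0 < snd i}. a i * (real (snd i) * M (fst i, snd i - 1)))"
        using fin by (intro sum.mono_neutral_right) auto
      also have "\<dots> = (\<Sum>m | mabs m = l - 3. real (snd m + 1) * a (fst m, snd m + 1) * M m)"
        by (rule sum.reindex_bij_witness[where i="\<lambda>m. (fst m, snd m + 1)" and j="\<lambda>i. (fst i, snd i - 1)"])
          (use l in \<open>auto simp: D_def mabs_def\<close>)
      finally show ?thesis .
    qed
    have b: "(\<Sum>i\<in>D. b i * (real (fst i) * M (fst i - 1, snd i)))
        = (\<Sum>m | mabs m = l - 3. real (fst m + 1) * b (fst m + 1, snd m) * M m)"
    proof -
      have "(\<Sum>i\<in>D. b i * (real (fst i) * M (fst i - 1, snd i)))
          = (\<Sum>i\<in>{i \<in> D. 0 < fst i}. b i * (real (fst i) * M (fst i - 1, snd i)))"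
        using fin by (intro sum.mono_neutral_right) auto
      also have "\<dots> = (\<Sum>m | mabs m = l - 3. real (fst m + 1) * b (fst m + 1, snd m) * M m)"
        by (rule sum.reindex_bij_witness[where i="\<lambda>m. (fst m + 1, snd m)" and j="\<lambda>i. (fst i - 1, snd i)"])
          (use l in \<open>auto simp: D_def mabs_def\<close>)
      finally show ?thesis .
    qed
    have "(\<Sum>m | mabs m \<le> l. d_coeff x j m * M m) = (\<Sum>m | mabs m = l - 3. d_coeff x j m * M m)"
      by (intro sum.mono_neutral_right) (auto simp: d_coeff_def l_def)
    also have "\<dots> = (\<Sum>m | mabs m = l - 3. real (snd m + 1) * a (fst m, snd m + 1) * M m
        - real (fst m + 1) * b (fst m + 1, snd m) * M m)"
      by (intro sum.cong refl) (auto simp: d_coeff_def l_def a_def b_def algebra_simps)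
    finally show ?thesis
      unfolding sum_subtractf a b ..
  qed
  \<comment> \<open>derivatives falling on the exponential, collected by \<open>m = i + \<kappa>\<close>\<close>
  have upper: "(\<Sum>i\<in>D. \<Sum>k | mabs k \<le> 3.
        (a i * (real (snd k + 1) * x (fst k, snd k + 1)) - b i * (real (fst k + 1) * x (fst k + 1, snd k)))
          * M (fst i + fst k, snd i + snd k))
      = (\<Sum>m | mabs m \<le> l + 1. (\<Sum>k\<in>I_set l m. h k m) * M m)"
  proof -
    have "(\<Sum>i\<in>D. \<Sum>k | mabs k \<le> 3.
        (a i * (real (snd k + 1) * x (fst k, snd k + 1)) - b i * (real (fst k + 1) * x (fst k + 1, snd k)))
          * M (fst i + fst k, snd i + snd k))
      = (\<Sum>(m, k)\<in>Sigma {m. mabs m \<le> l + 1} (I_set l). h k m * M m)"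
      using fin unfolding sum.Sigma[OF fin ballI, OF finite_mabs_le]
      by (intro sum.reindex_bij_witness[where
            i="\<lambda>(m, k). ((fst m - fst k, snd m - snd k), k)" and j="\<lambda>(i, k). ((fst i + fst k, snd i + snd k), k)"])
        (use l in \<open>auto simp: D_def mabs_def I_set_def h_def algebra_simps\<close>)
    also have "\<dots> = (\<Sum>m | mabs m \<le> l + 1. (\<Sum>k\<in>I_set l m. h k m) * M m)"
      by (subst sum.Sigma[symmetric]) (auto simp: sum_distrib_right)
    finally show ?thesis .
  qed
  have "0 = (\<Sum>i\<in>D. a i * (real (snd i) * M (fst i, snd i - 1)
        + (\<Sum>k | mabs k \<le> 3. real (snd k + 1) * x (fst k, snd k + 1) * M (fst i + fst k, snd i + snd k)))
      - b i * (real (fst i) * M (fst i - 1, snd i)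
        + (\<Sum>k | mabs k \<le> 3. real (fst k + 1) * x (fst k + 1, snd k) * M (fst i + fst k, snd i + snd k))))"
    unfolding ibp1 ibp2 by simp
  also have "\<dots> = (\<Sum>i\<in>D. (a i * (real (snd i) * M (fst i, snd i - 1)) - b i * (real (fst i) * M (fst i - 1, snd i)))
      + (\<Sum>k | mabs k \<le> 3.
        (a i * (real (snd k + 1) * x (fst k, snd k + 1)) - b i * (real (fst k + 1) * x (fst k + 1, snd k)))
          * M (fst i + fst k, snd i + snd k)))"
    by (intro sum.cong refl)
      (simp add: distrib_left sum_distrib_left sum_subtractf left_diff_distrib mult.assoc)
  also have "\<dots> = (\<Sum>m | mabs m \<le> l. d_coeff x j m * M m)
      + (\<Sum>m | mabs m \<le> l + 1. (\<Sum>k\<in>I_set l m. h k m) * M m)"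
    unfolding sum.distrib lower upper ..
  also have "(\<Sum>m | mabs m \<le> l + 1. (\<Sum>k\<in>I_set l m. h k m) * M m)
      = (\<Sum>m | mabs m \<le> l. (\<Sum>k\<in>I_set l m. h k m) * M m) + (\<Sum>m | mabs m = l + 1. (\<Sum>k\<in>I_set l m. h k m) * M m)"
    by (subst sum.union_disjoint[symmetric]) (auto intro!: sum.cong)
  also have "(\<Sum>m | mabs m = l + 1. (\<Sum>k\<in>I_set l m. h k m) * M m) = (\<Sum>m | mabs m = l + 1. if m = j then - M m else 0)"
  proof (rule sum.cong[OF refl])
    fix m :: mindex assume "m \<in> {m. mabs m = l + 1}"
    then have m: "mabs m = mabs j" using l by simp
    show "(\<Sum>k\<in>I_set l m. h k m) * M m = (if m = j then - M m else 0)"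
      using top_degree_coefficient[where x=x, OF x40 det j m]
      unfolding l_def[symmetric] a_def[symmetric] b_def[symmetric] h_def by simp
  qed
  also have "\<dots> = - M j"
    using l by (simp add: sum.delta')
  finally have "M j = (\<Sum>m | mabs m \<le> l. d_coeff x j m * M m) + (\<Sum>m | mabs m \<le> l. (\<Sum>k\<in>I_set l m. h k m) * M m)"
    by simp
  also have "\<dots> = (\<Sum>m | mabs m \<le> l. c_coeff x j m * M m)"
    unfolding c_coeff_def l_def[symmetric] a_def[symmetric] b_def[symmetric] h_def[symmetric] sum.distrib[symmetric]
    by (intro sum.cong refl) (simp add: algebra_simps)
  also have "{m. mabs m \<le> l} = {m. mabs m < mabs j}" using l by auto
  finally show ?thesis .
qed

lemma moments_by_r:
  fixes M x :: "mindex \<Rightarrow> real"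
  assumes red: "\<And>j. 5 \<le> mabs j \<Longrightarrow> M j = (\<Sum>m\<in>{m. mabs m < mabs j}. c_coeff x j m * M m)"
  shows "M j = (\<Sum>i | mabs i \<le> 4. r x j i * M i)"
proof (induction "mabs j" arbitrary: j rule: less_induct)
  case less
  show ?case
  proof (cases "mabs j \<le> 4")
    case True
    then show ?thesis
      by (subst r.simps) (simp add: if_distrib[of "\<lambda>c. c * _"] cong: if_cong)
  next
    case False
    then have "M j = (\<Sum>m\<in>{m. mabs m < mabs j}. c_coeff x j m * M m)"
      by (intro red) simp
    also have "\<dots> = (\<Sum>m\<in>{m. mabs m < mabs j}. c_coeff x j m * (\<Sum>i | mabs i \<le> 4. r x m i * M i))"
      using less by (intro sum.cong refl) auto
    also have "\<dots> = (\<Sum>i | mabs i \<le> 4. (\<Sum>m\<in>{m. mabs m < mabs j}. c_coeff x j m * r x m i) * M i)"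
      unfolding sum_distrib_left sum_distrib_right by (subst sum.swap) (simp add: mult.assoc)
    also have "\<dots> = (\<Sum>i | mabs i \<le> 4. r x j i * M i)"
      using False by (subst (2) r.simps) simp
    finally show ?thesis .
  qed
qed

section \<open>The dual functional of entropy maximization\<close>

definition exp_mass :: "(mindex \<Rightarrow> real) \<Rightarrow> ennreal"
  where "exp_mass y = (\<integral>\<^sup>+t. ennreal (exp (quartic y t)) \<partial>lebesgue)"

definition pairing :: "(mindex \<Rightarrow> real) \<Rightarrow> (mindex \<Rightarrow> real) \<Rightarrow> real"
  where "pairing g y = (\<Sum>i | mabs i \<le> 4. g i * y i)"

lemma pairing_linear: "pairing g (\<lambda>i. a * x i + b * y i) = a * pairing g x + b * pairing g y"
  by (simp add: pairing_def distrib_left sum.distrib sum_distrib_left mult_ac)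

lemma pairing_single:
  assumes "mabs i \<le> 4"
  shows "pairing g (\<lambda>k. x k + (if k = i then s else 0)) = pairing g x + s * g i"
  using assms by (simp add: pairing_def distrib_left sum.distrib if_distrib[of "\<lambda>c. _ * c"] cong: if_cong)

lemma tendsto_pairing:
  assumes "\<And>i. mabs i \<le> 4 \<Longrightarrow> (\<lambda>n. y n i) \<longlonglongrightarrow> q i"
  shows "(\<lambda>n. pairing g (y n)) \<longlonglongrightarrow> pairing g q"
  unfolding pairing_def using assms by (intro tendsto_intros) auto

text \<open>
Superlevel sets are all that the compactness argument needs, and they can be described without
extended real arithmetic. The second conjunct says that nothing is truncated in the first, where
\<open>ennreal\<close> would map a negative number to 0.
\<close>

lemma L0_ge_iff: "ereal C \<le> L0 g y \<longleftrightarrow> exp_mass y \<le> ennreal (pairing g y - C) \<and> C \<le> pairing g y"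
proof (cases "exp_mass y")
  case (real z)
  then have "L0 g y = ereal (pairing g y - z)"
    unfolding L0_def exp_mass_def[symmetric] pairing_def[symmetric] by simp
  then show ?thesis using real by (auto simp: ennreal_le_iff2)
next
  case top
  then have "L0 g y = -\<infinity>"
    unfolding L0_def exp_mass_def[symmetric] pairing_def[symmetric] by simp
  then show ?thesis using top by (auto simp: top_unique)
qed

lemma L0_eq_integral:
  assumes "integrable lebesgue (\<lambda>t. exp (quartic y t))"
  shows "L0 g y = ereal (pairing g y - (LINT t|lebesgue. exp (quartic y t)))"
proof -
  have "exp_mass y = ennreal (LINT t|lebesgue. exp (quartic y t))"
    unfolding exp_mass_def using assms by (intro nn_integral_eq_integral) auto
  then show ?thesis
    unfolding L0_def exp_mass_def[symmetric] pairing_def[symmetric] by simp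
qed

lemma integrable_if_L0_ge:
  assumes "ereal C \<le> L0 g y"
  shows "integrable lebesgue (\<lambda>t. exp (quartic y t))"
proof (rule integrableI_nonneg)
  show "(\<integral>\<^sup>+t. ennreal (exp (quartic y t)) \<partial>lebesgue) < \<infinity>"
    using assms unfolding L0_ge_iff exp_mass_def by (auto intro: le_less_trans)
qed auto

text \<open>
The exponential integral is lower semicontinuous by Fatou's lemma, and the linear part is
continuous. Mass can escape to infinity in the limit, so semicontinuity is all one can expect.
\<close>

lemma L0_upper_semicontinuous:
  assumes C: "\<And>n. ereal C \<le> L0 g (y n)"
    and lim: "\<And>i. mabs i \<le> 4 \<Longrightarrow> (\<lambda>n. y n i) \<longlonglongrightarrow> q i"
  shows "ereal C \<le> L0 g q"
proof -
  have p: "(\<lambda>n. pairing g (y n)) \<longlonglongrightarrow> pairing g q" by (rule tendsto_pairing[OF lim])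
  have "exp_mass q = (\<integral>\<^sup>+t. liminf (\<lambda>n. ennreal (exp (quartic (y n) t))) \<partial>lebesgue)"
    unfolding exp_mass_def
  proof (rule nn_integral_cong)
    fix t
    have "(\<lambda>n. ennreal (exp (quartic (y n) t))) \<longlonglongrightarrow> ennreal (exp (quartic q t))"
      by (intro tendsto_ennrealI tendsto_exp tendsto_quartic[OF lim])
    then show "ennreal (exp (quartic q t)) = liminf (\<lambda>n. ennreal (exp (quartic (y n) t)))"
      by (intro lim_imp_Liminf[symmetric]) auto
  qed
  also have "\<dots> \<le> liminf (\<lambda>n. exp_mass (y n))"
    unfolding exp_mass_def by (intro nn_integral_liminf) measurable
  also have "\<dots> \<le> liminf (\<lambda>n. ennreal (pairing g (y n) - C))"
    using C unfolding L0_ge_iff by (intro Liminf_mono) auto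
  also have "\<dots> = ennreal (pairing g q - C)"
    by (intro lim_imp_Liminf tendsto_ennrealI tendsto_intros p) auto
  finally have "exp_mass q \<le> ennreal (pairing g q - C)" .
  moreover have "C \<le> pairing g q"
    using C unfolding L0_ge_iff by (intro LIMSEQ_le_const[OF p]) auto
  ultimately show ?thesis unfolding L0_ge_iff by simp
qed

text \<open>
The quartic \<open>-t\<^sub>1\<^sup>4 - t\<^sub>2\<^sup>4\<close> is negative definite, so its exponential is integrable. The zero vector
would not do: its value is \<open>-\<infinity>\<close>.
\<close>

lemma L0_finite_somewhere: "\<exists>x\<in>R15. \<exists>C. L0 g x = ereal C"
proof -
  define x0 :: "mindex \<Rightarrow> real" where "x0 i = (if i = (4, 0) \<or> i = (0, 4) then -1 else 0)" for i
  have x0_top: "(\<Sum>i | mabs i = 4. x0 i * mpow t i) < 0" if "t \<noteq> 0" for t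
  proof -
    have "(\<Sum>i | mabs i = 4. x0 i * mpow t i) = (\<Sum>i\<in>{(4, 0), (0, 4)}. x0 i * mpow t i)"
      by (rule sum.mono_neutral_right[OF finite_mabs_eq]) (auto simp: mabs_def x0_def)
    also have "\<dots> = - (fst t ^ 4 + snd t ^ 4)" by (simp add: x0_def mpow_def)
    also have "\<dots> < 0"
    proof -
      have "fst t \<noteq> 0 \<or> snd t \<noteq> 0" using that by (auto simp: prod_eq_iff)
      moreover have "fst t ^ 4 \<ge> 0" "snd t ^ 4 \<ge> 0" by (auto intro: zero_le_even_power)
      moreover have "a ^ 4 \<noteq> 0" if "a \<noteq> 0" for a :: real using that by simp
      ultimately show ?thesis by (smt (verit))
    qed
    finally show ?thesis .
  qed
  have "integrable lborel (\<lambda>t. mpow t (0, 0) * exp (quartic x0 t))"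
    by (rule integrable_moment[OF x0_top])
  then have "integrable lebesgue (\<lambda>t. exp (quartic x0 t))"
    by (subst integrable_completion) (auto simp: mpow_def)
  from L0_eq_integral[OF this] have "\<exists>C. L0 g x0 = ereal C" by blast
  moreover have "x0 \<in> R15" by (auto simp: R15_def x0_def mabs_def)
  ultimately show ?thesis by blast
qed

section \<open>Existence and uniqueness of the maximizer\<close>

text \<open>
This is where the representing density enters: it turns the linear part of \<open>L0\<close> into an integral,
so that signs of polynomials become signs of the linear part.
\<close>

lemma pairing_eq_integral:
  assumes "representing_density f g"
  shows "integrable lebesgue (\<lambda>t. quartic y t * f t)"
    and "pairing g y = (LINT t|lebesgue. quartic y t * f t)"
proof -
  have [measurable]: "f \<in> borel_measurable lebesgue" using assms by (simp add: representing_density_def)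
  have int: "integrable lebesgue (\<lambda>t. mpow t i * f t)" if "mabs i \<le> 4" for i
  proof (rule Bochner_Integration.integrable_bound)
    show "integrable lebesgue (\<lambda>t. \<bar>mpow t i\<bar> * f t)"
      using assms that unfolding representing_density_def by blast
  qed (auto simp: abs_mult)
  have eq: "quartic y t * f t = (\<Sum>i | mabs i \<le> 4. y i * (mpow t i * f t))" for t
    by (simp add: quartic_def sum_distrib_right mult.assoc)
  show "integrable lebesgue (\<lambda>t. quartic y t * f t)"
    unfolding eq using int by (intro Bochner_Integration.integrable_sum integrable_mult_right) auto
  show "pairing g y = (LINT t|lebesgue. quartic y t * f t)"
    unfolding eq pairing_def using assms int
    by (subst Bochner_Integration.integral_sum) (auto intro!: sum.cong simp: representing_density_def mult.commute)
qed

lemma pairing_negative: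
  assumes f: "representing_density f g" and neg: "AE t in lebesgue. quartic q t < 0"
  shows "pairing g q < 0"
proof -
  have pos: "AE t in lebesgue. 0 \<le> f t" and nz: "\<not> (AE t in lebesgue. f t = 0)"
    using f by (auto simp: representing_density_def)
  have int: "integrable lebesgue (\<lambda>t. - (quartic q t * f t))"
    using pairing_eq_integral(1)[OF f] by simp
  have nonneg: "AE t in lebesgue. 0 \<le> - (quartic q t * f t)"
    using pos neg by eventually_elim (simp add: mult_nonpos_nonneg)
  have "(LINT t|lebesgue. - (quartic q t * f t)) \<noteq> 0"
  proof
    assume "(LINT t|lebesgue. - (quartic q t * f t)) = 0"
    then have "AE t in lebesgue. - (quartic q t * f t) = 0"
      using integral_nonneg_eq_0_iff_AE[OF int nonneg] by simp
    with neg have "AE t in lebesgue. f t = 0" by eventually_elim auto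
    with nz show False by simp
  qed
  moreover have "(LINT t|lebesgue. - (quartic q t * f t)) \<ge> 0"
    using nonneg by (rule integral_nonneg_AE)
  ultimately show ?thesis
    using pairing_eq_integral(2)[OF f, of q] by simp
qed

text \<open>
Bolzano-Weierstrass for coefficient vectors, which are functions on an infinite index type and do
not form a Euclidean space.
\<close>

lemma convergent_subsequence_on_finite_set:
  fixes y :: "nat \<Rightarrow> 'a \<Rightarrow> real"
  assumes "finite I" and "\<And>n i. i \<in> I \<Longrightarrow> \<bar>y n i\<bar> \<le> B"
  shows "\<exists>s q. strict_mono (s :: nat \<Rightarrow> nat) \<and> (\<forall>i\<in>I. (\<lambda>n. y (s n) i) \<longlonglongrightarrow> q i)"
  using assms
proof (induction I rule: finite_induct)
  case empty
  then show ?case by (auto intro!: exI[of _ id] simp: strict_mono_id)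
next
  case (insert a I)
  then obtain s q where s: "strict_mono s" and q: "\<forall>i\<in>I. (\<lambda>n. y (s n) i) \<longlonglongrightarrow> q i"
    by (metis insertCI)
  have "bounded (range (\<lambda>n. y (s n) a))"
    using insert.prems[of a] by (auto simp: bounded_iff)
  then obtain c r where r: "strict_mono r" and c: "((\<lambda>n. y (s n) a) \<circ> r) \<longlonglongrightarrow> c"
    using bounded_imp_convergent_subsequence by blast
  have "(\<lambda>n. y ((s \<circ> r) n) i) \<longlonglongrightarrow> (q(a := c)) i" if "i \<in> insert a I" for i
  proof (cases "i = a")
    case True
    then show ?thesis using c by (simp add: comp_def)
  next
    case False
    then have "(\<lambda>n. y (s n) i) \<longlonglongrightarrow> q i" using that q by auto
    from LIMSEQ_subseq_LIMSEQ[OF this r] show ?thesis using False by (simp add: comp_def)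
  qed
  moreover have "strict_mono (s \<circ> r)" using s r by (rule strict_mono_o)
  ultimately show ?case by blast
qed

text \<open>
Otherwise there are \<open>y\<^sub>n\<close> in the superlevel set with norms \<open>N\<^sub>n\<close> tending to infinity, and after
normalization \<open>y\<^sub>n / N\<^sub>n\<close> converges to a direction \<open>p\<close> of norm 1. The superlevel condition bounds
the integrals of \<open>exp (N\<^sub>n p\<^sub>n) / N\<^sub>n\<close>, where \<open>p\<^sub>n\<close> is the normalized polynomial. These functions tend
to infinity wherever \<open>p > 0\<close>, so \<open>p \<le> 0\<close> almost everywhere by Fatou's lemma, hence \<open>p < 0\<close> almost
everywhere, and \<open>\<langle>g, p\<rangle> < 0\<close>. But the superlevel condition also gives \<open>\<langle>g, y\<^sub>n\<rangle> \<ge> C\<close>, and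
dividing by \<open>N\<^sub>n\<close> one finds \<open>\<langle>g, p\<rangle> \<ge> 0\<close>.
\<close>

lemma L0_superlevel_bounded:
  assumes f: "representing_density f g"
  shows "\<exists>B. \<forall>y. ereal C \<le> L0 g y \<longrightarrow> (\<Sum>i | mabs i \<le> 4. \<bar>y i\<bar>) \<le> B"
proof (rule ccontr)
  define N where "N y = (\<Sum>i | mabs i \<le> 4. \<bar>y i\<bar>)" for y :: "mindex \<Rightarrow> real"
  assume "\<not> ?thesis"
  then have "\<forall>n :: nat. \<exists>y. ereal C \<le> L0 g y \<and> N y > real n + 1"
    unfolding N_def by (metis not_le)
  then obtain y0 where y0: "\<And>n :: nat. ereal C \<le> L0 g (y0 n)" "\<And>n :: nat. N (y0 n) > real n + 1"
    by metis
  have "\<bar>y0 n i / N (y0 n)\<bar> \<le> 1" if "i \<in> {i. mabs i \<le> 4}" for n i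
  proof -
    have "\<bar>y0 n i\<bar> \<le> N (y0 n)"
      unfolding N_def by (rule member_le_sum[OF that]) auto
    then show ?thesis using y0(2)[of n] by (simp add: divide_le_eq)
  qed
  from convergent_subsequence_on_finite_set[OF finite_mabs_le, of 4 "\<lambda>n i. y0 n i / N (y0 n)" 1, OF this]
  obtain s p where s: "strict_mono (s :: nat \<Rightarrow> nat)"
    and p: "\<And>i. mabs i \<le> 4 \<Longrightarrow> (\<lambda>n. y0 (s n) i / N (y0 (s n))) \<longlonglongrightarrow> p i"
    by auto
  define y where "y n = y0 (s n)" for n
  define q where "q n = (\<lambda>i. y n i / N (y n))" for n
  have y: "ereal C \<le> L0 g (y n)" for n unfolding y_def by (rule y0)
  have Ny: "N (y n) > real n + 1" for n
    using y0(2)[of "s n"] seq_suble[OF s, of n] unfolding y_def by linarith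
  then have Npos: "N (y n) \<ge> 1" "N (y n) > 0" for n by (smt (verit) of_nat_0_le_iff)+
  have Ntop: "filterlim (\<lambda>n. N (y n)) at_top sequentially"
  proof (rule filterlim_at_top_mono)
    show "filterlim real at_top sequentially" by (rule filterlim_real_sequentially)
    show "\<forall>\<^sub>F n in sequentially. real n \<le> N (y n)"
      using Ny by (intro always_eventually allI) (smt (verit))
  qed
  have q: "(\<lambda>n. q n i) \<longlonglongrightarrow> p i" if "mabs i \<le> 4" for i
    using p[OF that] by (simp add: q_def y_def)
  have pair: "pairing g (y n) = N (y n) * pairing g (q n)" for n
    using Npos(2)[of n] unfolding pairing_def sum_distrib_left by (intro sum.cong refl) (simp add: q_def)
  have quart: "quartic (y n) t = N (y n) * quartic (q n) t" for n t
    using Npos(2)[of n] unfolding quartic_def sum_distrib_left by (intro sum.cong refl) (simp add: q_def)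
  have Nq: "N (q n) = 1" for n
  proof -
    have "N (q n) = N (y n) / N (y n)"
      unfolding N_def[of "q n"] using Npos(2)[of n]
      by (simp add: q_def abs_divide sum_divide_distrib[symmetric] N_def[symmetric])
    then show ?thesis using Npos(2)[of n] by simp
  qed
  have "(\<lambda>n. N (q n)) \<longlonglongrightarrow> N p"
    unfolding N_def by (intro tendsto_intros q) auto
  then have "N p = 1" unfolding Nq by (simp add: LIMSEQ_const_iff)
  then obtain i where i: "mabs i \<le> 4" "p i \<noteq> 0"
    unfolding N_def by (metis (mono_tags, lifting) abs_zero mem_Collect_eq sum.neutral zero_neq_one)
  define K where "K = (\<Sum>i | mabs i \<le> 4. \<bar>g i\<bar>) + \<bar>C\<bar>"
  have K: "pairing g (y n) - C \<le> N (y n) * K" for n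
  proof -
    have "pairing g (q n) \<le> (\<Sum>i | mabs i \<le> 4. \<bar>g i\<bar>)"
      unfolding pairing_def
    proof (rule sum_mono)
      fix i :: mindex assume i: "i \<in> {i. mabs i \<le> 4}"
      have "\<bar>q n i\<bar> \<le> N (q n)" unfolding N_def by (rule member_le_sum[OF i]) auto
      then have "\<bar>g i * q n i\<bar> \<le> \<bar>g i\<bar>" unfolding Nq abs_mult by (simp add: mult_left_le)
      then show "g i * q n i \<le> \<bar>g i\<bar>" by linarith
    qed
    then have "N (y n) * pairing g (q n) \<le> N (y n) * (\<Sum>i | mabs i \<le> 4. \<bar>g i\<bar>)"
      using Npos(2)[of n] by (intro mult_left_mono) auto
    moreover have "- C \<le> N (y n) * \<bar>C\<bar>"
      using mult_right_mono[OF Npos(1)[of n], of "\<bar>C\<bar>"] by auto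
    ultimately show ?thesis by (simp add: pair K_def distrib_left)
  qed
  define h where "h n t = ennreal (inverse (N (y n))) * ennreal (exp (quartic (y n) t))" for n t
  have meas [measurable]: "h n \<in> borel_measurable lebesgue" for n
    unfolding h_def by measurable
  have h_int: "(\<integral>\<^sup>+t. h n t \<partial>lebesgue) \<le> ennreal K" for n
  proof -
    have "(\<integral>\<^sup>+t. h n t \<partial>lebesgue) = ennreal (inverse (N (y n))) * exp_mass (y n)"
      unfolding h_def exp_mass_def by (rule nn_integral_cmult) measurable
    also have "\<dots> \<le> ennreal (inverse (N (y n))) * ennreal (N (y n) * K)"
      using y[of n] K[of n] unfolding L0_ge_iff by (intro mult_left_mono) (auto intro: order_trans ennreal_leI)
    also have "\<dots> = ennreal K"
      using Npos(2)[of n] by (simp add: ennreal_mult'[symmetric] mult.assoc[symmetric])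
    finally show ?thesis .
  qed
  have "(\<integral>\<^sup>+t. liminf (\<lambda>n. h n t) \<partial>lebesgue) \<le> liminf (\<lambda>n. \<integral>\<^sup>+t. h n t \<partial>lebesgue)"
    by (rule nn_integral_liminf) measurable
  also have "\<dots> \<le> liminf (\<lambda>n :: nat. ennreal K)"
    using h_int by (intro Liminf_mono) auto
  also have "\<dots> = ennreal K" by (simp add: Liminf_const)
  finally have fin: "(\<integral>\<^sup>+t. liminf (\<lambda>n. h n t) \<partial>lebesgue) \<noteq> \<infinity>"
    by (metis ennreal_less_top infinity_ennreal_def not_le)
  have "AE t in lebesgue. liminf (\<lambda>n. h n t) \<noteq> \<infinity>"
    by (rule nn_integral_PInf_AE[OF _ fin]) measurable
  moreover have "AE t in lebesgue. quartic p t \<noteq> 0"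
    by (rule AE_quartic_nonzero[of i]) (use i in auto)
  ultimately have "AE t in lebesgue. quartic p t < 0"
  proof eventually_elim
    case (elim t)
    show ?case
    proof (rule ccontr)
      assume "\<not> quartic p t < 0"
      then have pos: "quartic p t > 0" using elim(2) by linarith
      have qt: "(\<lambda>n. quartic (q n) t) \<longlonglongrightarrow> quartic p t"
        by (rule tendsto_quartic[OF q])
      \<comment> \<open>from \<open>e\<^sup>v \<ge> v\<^sup>2/2\<close> with \<open>v = N\<^sub>n p\<^sub>n(t)\<close>\<close>
      have "filterlim (\<lambda>n. (quartic (q n) t)\<^sup>2 / 2 * N (y n)) at_top sequentially"
      proof (rule filterlim_tendsto_pos_mult_at_top[OF _ _ Ntop])
        show "(\<lambda>n. (quartic (q n) t)\<^sup>2 / 2) \<longlonglongrightarrow> (quartic p t)\<^sup>2 / 2"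
          by (intro tendsto_intros qt) simp
        show "(quartic p t)\<^sup>2 / 2 > 0" using pos by simp
      qed
      moreover have "\<forall>\<^sub>F n in sequentially. (quartic (q n) t)\<^sup>2 / 2 * N (y n) \<le> inverse (N (y n)) * exp (quartic (y n) t)"
        using order_tendstoD(1)[OF qt pos]
      proof eventually_elim
        case (elim n)
        then have "0 \<le> quartic (y n) t" using Npos(2)[of n] by (simp add: quart)
        then have "(quartic (y n) t)\<^sup>2 / 2 \<le> exp (quartic (y n) t)"
          using exp_lower_Taylor_quadratic[of "quartic (y n) t"] by linarith
        then have "inverse (N (y n)) * ((quartic (y n) t)\<^sup>2 / 2) \<le> inverse (N (y n)) * exp (quartic (y n) t)"
          using Npos(2)[of n] by (intro mult_left_mono) auto
        then show ?case
          using Npos(2)[of n] by (simp add: quart power2_eq_square field_simps)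
      qed
      ultimately have "filterlim (\<lambda>n. inverse (N (y n)) * exp (quartic (y n) t)) at_top sequentially"
        by (rule filterlim_at_top_mono)
      then have "(\<lambda>n. ennreal (inverse (N (y n)) * exp (quartic (y n) t))) \<longlonglongrightarrow> top"
        by (simp add: ennreal_tendsto_top_eq_at_top)
      then have "(\<lambda>n. h n t) \<longlonglongrightarrow> \<infinity>"
        using Npos(2) by (simp add: h_def ennreal_mult' less_imp_le)
      then have "liminf (\<lambda>n. h n t) = \<infinity>" by (intro lim_imp_Liminf) auto
      with elim(1) show False by simp
    qed
  qed
  then have "pairing g p < 0" by (rule pairing_negative[OF f])
  moreover have "0 \<le> pairing g p"
  proof (rule LIMSEQ_le)
    show "(\<lambda>n. pairing g (q n)) \<longlonglongrightarrow> pairing g p" by (rule tendsto_pairing[OF q])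
    show "(\<lambda>n. C / N (y n)) \<longlonglongrightarrow> 0"
      by (rule real_tendsto_divide_at_top[OF tendsto_const Ntop])
    have "C / N (y n) \<le> pairing g (q n)" for n
      using y[of n] Npos(2)[of n] unfolding L0_ge_iff pair by (simp add: field_simps)
    then show "\<exists>N'. \<forall>n\<ge>N'. C / N (y n) \<le> pairing g (q n)" by blast
  qed
  ultimately show False by simp
qed

text \<open>
A maximizing sequence, taken inside a nonempty superlevel set, is bounded; by semicontinuity the
limit of a convergent subsequence is a maximizer.
\<close>

lemma L0_maximizer_exists:
  assumes f: "representing_density f g"
  shows "\<exists>x\<in>R15. \<forall>y\<in>R15. L0 g y \<le> L0 g x"
proof -
  obtain x0 C where x0: "x0 \<in> R15" and C: "L0 g x0 = ereal C"
    using L0_finite_somewhere by blast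
  define V where "V = L0 g ` {y \<in> R15. ereal C \<le> L0 g y}"
  have "V \<noteq> {}" using x0 C by (auto simp: V_def)
  then obtain v :: "nat \<Rightarrow> ereal" where v: "incseq v" "range v \<subseteq> V" "Sup V = (SUP n. v n)"
    using Sup_countable_SUP by blast
  have "\<forall>n. \<exists>y. y \<in> R15 \<and> ereal C \<le> L0 g y \<and> v n = L0 g y"
    using v(2) by (auto simp: V_def)
  then obtain y where y: "\<And>n. y n \<in> R15" "\<And>n. ereal C \<le> L0 g (y n)" "\<And>n. v n = L0 g (y n)"
    by metis
  obtain B where B: "\<And>y. ereal C \<le> L0 g y \<Longrightarrow> (\<Sum>i | mabs i \<le> 4. \<bar>y i\<bar>) \<le> B"
    using L0_superlevel_bounded[OF f] by blast
  have "\<bar>y n i\<bar> \<le> B" if "i \<in> {i. mabs i \<le> 4}" for n i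
    using member_le_sum[OF that, of "\<lambda>i. \<bar>y n i\<bar>"] B[OF y(2)[of n]] by auto
  from convergent_subsequence_on_finite_set[OF finite_mabs_le, of 4 y B, OF this]
  obtain s q where s: "strict_mono (s :: nat \<Rightarrow> nat)"
    and q: "\<And>i. mabs i \<le> 4 \<Longrightarrow> (\<lambda>n. y (s n) i) \<longlonglongrightarrow> q i"
    by auto
  \<comment> \<open>convergence is only known for \<open>|i| \<le> 4\<close>; the other components of a vector are 0\<close>
  define x where "x i = (if mabs i \<le> 4 then q i else 0)" for i
  have "v m \<le> L0 g x" for m
  proof -
    obtain c where c: "v m = ereal c"
    proof (cases "v m")
      case PInf
      then have "ereal (pairing g (y m) + 1) \<le> L0 g (y m)" using y(3)[of m] by simp
      then show ?thesis unfolding L0_ge_iff by simp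
    next
      case MInf
      then have "L0 g (y m) = -\<infinity>" using y(3)[of m] by simp
      with y(2)[of m] show ?thesis by simp
    qed
    have "ereal c \<le> L0 g x"
    proof (rule L0_upper_semicontinuous)
      show "ereal c \<le> L0 g (y (s (n + m)))" for n
        using incseqD[OF v(1), of m "s (n + m)"] seq_suble[OF s, of "n + m"] c y(3)[of "s (n + m)"] by simp
      show "(\<lambda>n. y (s (n + m)) i) \<longlonglongrightarrow> x i" if "mabs i \<le> 4" for i
        using LIMSEQ_ignore_initial_segment[OF q[OF that], of m] that by (simp add: x_def)
    qed
    then show ?thesis by (simp add: c)
  qed
  then have Sup: "Sup V \<le> L0 g x" unfolding v(3) by (rule SUP_least)
  have "L0 g z \<le> L0 g x" if "z \<in> R15" for z
  proof (cases "ereal C \<le> L0 g z")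
    case True
    then have "L0 g z \<in> V" using that by (auto simp: V_def)
    then show ?thesis using Sup by (meson Sup_upper order_trans)
  next
    case False
    have "ereal C \<in> V" using x0 C by (force simp: V_def)
    then show ?thesis using Sup False by (meson Sup_upper order_trans linear)
  qed
  moreover have "x \<in> R15" by (auto simp: R15_def x_def)
  ultimately show ?thesis by blast
qed

text \<open>
At the midpoint of two maximizers the linear part is the mean of the two linear parts, while the
arithmetic-geometric mean inequality \<open>exp ((u + v)/2) \<le> (exp u + exp v)/2\<close>, strict unless \<open>u = v\<close>, makes the
integral smaller. So the two quartics agree almost everywhere, that is, their coefficients agree.
\<close>

lemma L0_maximizer_unique:
  assumes f: "representing_density f g"
    and x: "x \<in> R15" "\<forall>y\<in>R15. L0 g y \<le> L0 g x"
    and z: "z \<in> R15" "\<forall>y\<in>R15. L0 g y \<le> L0 g z"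
  shows "x = z"
proof (rule ccontr)
  assume "x \<noteq> z"
  then obtain i where i: "x i \<noteq> z i" by blast
  have i4: "mabs i \<le> 4"
  proof (rule ccontr)
    assume "\<not> mabs i \<le> 4"
    then have "x i = 0" "z i = 0" using x(1) z(1) by (auto simp: R15_def simp del: split_paired_All)
    with i show False by simp
  qed
  have eq: "L0 g z = L0 g x" using x z by (simp add: antisym)
  obtain C where C: "ereal C \<le> L0 g x" using L0_finite_somewhere[of g] x(2) by metis
  let ?E = "\<lambda>y t. exp (quartic y t)"
  have ix: "integrable lebesgue (?E x)" by (rule integrable_if_L0_ge[OF C])
  have iz: "integrable lebesgue (?E z)" by (rule integrable_if_L0_ge[of C g]) (simp add: eq C)
  define m where "m i = (1/2) * x i + (1/2) * z i" for i
  have m_R15: "m \<in> R15" using x(1) z(1) by (simp add: R15_def m_def)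
  have qm: "quartic m t = (quartic x t + quartic z t) / 2" for t
    unfolding m_def quartic_linear by simp
  have gap: "(?E x t + ?E z t) / 2 - ?E m t = (exp (quartic x t / 2) - exp (quartic z t / 2))\<^sup>2 / 2" for t
  proof -
    have "?E m t = exp (quartic x t / 2) * exp (quartic z t / 2)"
      by (simp add: qm add_divide_distrib exp_add)
    moreover have "?E y t = (exp (quartic y t / 2))\<^sup>2" for y
      by (simp add: power2_eq_square exp_add[symmetric])
    ultimately show ?thesis by (simp add: power2_diff field_simps)
  qed
  have gap_nonneg: "0 \<le> (?E x t + ?E z t) / 2 - ?E m t" for t unfolding gap by simp
  have im: "integrable lebesgue (?E m)"
  proof (rule Bochner_Integration.integrable_bound)
    show "integrable lebesgue (\<lambda>t. (?E x t + ?E z t) / 2)" using ix iz by simp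
    show "AE t in lebesgue. norm (?E m t) \<le> norm ((?E x t + ?E z t) / 2)"
      using gap_nonneg by (intro AE_I2) (smt (verit) exp_gt_zero real_norm_def)
  qed measurable
  have igap: "integrable lebesgue (\<lambda>t. (?E x t + ?E z t) / 2 - ?E m t)" using ix iz im by simp
  define J where "J y = (LINT t|lebesgue. ?E y t)" for y
  have "L0 g x = ereal (pairing g x - J x)" "L0 g z = ereal (pairing g z - J z)"
      "L0 g m = ereal (pairing g m - J m)"
    unfolding J_def by (rule L0_eq_integral, rule ix iz im)+
  moreover have "L0 g m \<le> L0 g x" using x(2) m_R15 by blast
  moreover have "pairing g m = (pairing g x + pairing g z) / 2"
    unfolding m_def pairing_linear by simp
  ultimately have "(J x + J z) / 2 \<le> J m" using eq by (simp add: field_simps)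
  then have "(LINT t|lebesgue. (?E x t + ?E z t) / 2 - ?E m t) \<le> 0"
    using ix iz im by (simp add: J_def)
  moreover have "0 \<le> (LINT t|lebesgue. (?E x t + ?E z t) / 2 - ?E m t)"
    by (rule integral_nonneg_AE) (use gap_nonneg in auto)
  ultimately have "AE t in lebesgue. (?E x t + ?E z t) / 2 - ?E m t = 0"
    using integral_nonneg_eq_0_iff_AE[OF igap] gap_nonneg by (auto intro: antisym)
  moreover have "AE t in lebesgue. quartic (\<lambda>i. 1 * x i + (-1) * z i) t \<noteq> 0"
    by (rule AE_quartic_nonzero[OF i4]) (use i in simp)
  ultimately have "AE t in (lebesgue :: (real \<times> real) measure). False"
    by eventually_elim (simp only: gap quartic_linear, simp)
  with not_AE_lebesgue_False show False ..
qed

lemma lambda_star_maximizes: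
  assumes "representing_density f g"
  shows "lambda_star g \<in> R15" and "\<And>y. y \<in> R15 \<Longrightarrow> L0 g y \<le> L0 g (lambda_star g)"
proof -
  have "\<exists>!x. x \<in> R15 \<and> (\<forall>y\<in>R15. L0 g y \<le> L0 g x)"
    using L0_maximizer_exists[OF assms] L0_maximizer_unique[OF assms] by blast
  from theI'[OF this] show "lambda_star g \<in> R15" "\<And>y. y \<in> R15 \<Longrightarrow> L0 g y \<le> L0 g (lambda_star g)"
    unfolding lambda_star_def by blast+
qed

section \<open>The moments of the maximum entropy density\<close>

text \<open>
The gradient of \<open>L0\<close> vanishes at a maximizer. Instead of differentiating under the integral, the
convexity inequality \<open>e\<^sup>v - e\<^sup>u \<le> (v - u) e\<^sup>v\<close> is applied at the points \<open>x \<plusminus> s e\<^sub>i\<close>: maximality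
then bounds \<open>\<plusminus> g\<^sub>i\<close> by the corresponding moment at the perturbed point, and \<open>s\<close> tends to 0 under
dominated convergence. The reserve in the growth estimate provides the majorant; it has to absorb
perturbations of degree 4, which is why negative definiteness of the leading form is essential.
\<close>

lemma moments_at_maximizer:
  assumes x: "x \<in> R15" "\<And>y. y \<in> R15 \<Longrightarrow> L0 g y \<le> L0 g x"
    and neg: "\<And>t. t \<noteq> 0 \<Longrightarrow> (\<Sum>i | mabs i = 4. x i * mpow t i) < 0"
    and i: "mabs i \<le> 4"
  shows "(LINT t|lebesgue. mpow t i * exp (quartic x t)) = g i"
proof -
  obtain c where c: "c > 0" and
    int: "\<And>j s. s \<le> c \<Longrightarrow> integrable lborel (\<lambda>t. mpow t j * exp (quartic x t + s * norm t ^ 4))"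
    using integrable_polynomial_exp_quartic[OF neg] by blast
  have dom_borel: "integrable lborel (\<lambda>t. exp c * \<bar>mpow t j * exp (quartic x t + c * norm t ^ 4)\<bar>)" for j
    using int[of c j] by simp
  have dom: "integrable lebesgue (\<lambda>t. exp c * \<bar>mpow t j * exp (quartic x t + c * norm t ^ 4)\<bar>)" for j
    using dom_borel[of j] by (subst integrable_completion) (simp_all add: borel_measurable_integrable)
  define I where "I = (LINT t|lebesgue. mpow t i * exp (quartic x t))"
  have one_sided: "\<sigma> * g i \<le> \<sigma> * I" if \<sigma>: "\<bar>\<sigma>\<bar> = 1" for \<sigma> :: real
  proof -
    define s where "s n = c / (real n + 1)" for n
    define y where "y n = (\<lambda>k. x k + (if k = i then \<sigma> * s n else 0))" for n
    have s: "0 < s n" "s n \<le> c" for n using c by (auto simp: s_def field_simps)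
    have y_R15: "y n \<in> R15" for n using x(1) i by (auto simp: R15_def y_def)
    have qy: "quartic (y n) t = quartic x t + \<sigma> * s n * mpow t i" for n t
      unfolding y_def by (rule quartic_single[OF i])
    have le: "exp (quartic (y n) t) \<le> exp c * exp (quartic x t + c * norm t ^ 4)" for n t
    proof -
      have "norm t ^ mabs i \<le> 1 + norm t ^ 4" using i by (intro power_le_one_plus_power) auto
      then have "\<bar>mpow t i\<bar> \<le> 1 + norm t ^ 4" using abs_mpow_le[of t i] by linarith
      then have "s n * \<bar>mpow t i\<bar> \<le> c * (1 + norm t ^ 4)"
        using s[of n] by (intro mult_mono) auto
      moreover have "\<bar>\<sigma> * s n * mpow t i\<bar> = s n * \<bar>mpow t i\<bar>"
        using s(1)[of n] \<sigma> by (simp add: abs_mult)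
      ultimately have "\<sigma> * s n * mpow t i \<le> c * (1 + norm t ^ 4)" by linarith
      then show ?thesis unfolding qy exp_add[symmetric] by (simp add: distrib_left)
    qed
    have bound: "norm (mpow t j * exp (quartic (y n) t)) \<le> exp c * \<bar>mpow t j * exp (quartic x t + c * norm t ^ 4)\<bar>" for n t j
    proof -
      have "\<bar>mpow t j\<bar> * exp (quartic (y n) t) \<le> \<bar>mpow t j\<bar> * (exp c * exp (quartic x t + c * norm t ^ 4))"
        by (intro mult_left_mono le) auto
      then show ?thesis by (simp add: abs_mult mult_ac)
    qed
    have int_y: "integrable lebesgue (\<lambda>t. mpow t j * exp (quartic (y n) t))" for j n
    proof (rule Bochner_Integration.integrable_bound[OF dom[of j]])
      show "AE t in lebesgue. norm (mpow t j * exp (quartic (y n) t))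
          \<le> norm (exp c * \<bar>mpow t j * exp (quartic x t + c * norm t ^ 4)\<bar>)"
        using bound by (intro AE_I2) (simp add: abs_mult)
    qed measurable
    have int_y0: "integrable lebesgue (\<lambda>t. exp (quartic (y n) t))" for n
      using int_y[of "(0, 0)" n] by (simp add: mpow_def)
    have int_x: "integrable lebesgue (\<lambda>t. exp (quartic x t))"
      using integrable_moment[OF neg, of "(0, 0)"]
      by (subst integrable_completion) (auto simp: mpow_def)
    have step: "\<sigma> * g i \<le> \<sigma> * (LINT t|lebesgue. mpow t i * exp (quartic (y n) t))" for n
    proof -
      have "L0 g (y n) \<le> L0 g x" using x(2) y_R15 by blast
      then have "\<sigma> * s n * g i \<le> (LINT t|lebesgue. exp (quartic (y n) t)) - (LINT t|lebesgue. exp (quartic x t))"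
        unfolding L0_eq_integral[OF int_x] L0_eq_integral[OF int_y0]
        by (simp add: y_def pairing_single[OF i])
      also have "\<dots> = (LINT t|lebesgue. exp (quartic (y n) t) - exp (quartic x t))"
        using int_x int_y0 by simp
      also have "\<dots> \<le> (LINT t|lebesgue. \<sigma> * s n * (mpow t i * exp (quartic (y n) t)))"
      proof (rule integral_mono)
        fix t
        have "(1 + (quartic x t - quartic (y n) t)) * exp (quartic (y n) t)
            \<le> exp (quartic x t - quartic (y n) t) * exp (quartic (y n) t)"
          by (intro mult_right_mono exp_ge_add_one_self) auto
        also have "\<dots> = exp (quartic x t)" by (simp add: exp_add[symmetric])
        finally show "exp (quartic (y n) t) - exp (quartic x t) \<le> \<sigma> * s n * (mpow t i * exp (quartic (y n) t))"
          unfolding qy[of n t] by (simp add: algebra_simps)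
      qed (use int_x int_y0 int_y in auto)
      also have "\<dots> = \<sigma> * s n * (LINT t|lebesgue. mpow t i * exp (quartic (y n) t))" by simp
      finally have "s n * (\<sigma> * g i) \<le> s n * (\<sigma> * (LINT t|lebesgue. mpow t i * exp (quartic (y n) t)))"
        by (simp add: mult_ac)
      then show ?thesis using s(1)[of n] by simp
    qed
    have "s \<longlonglongrightarrow> 0"
      unfolding s_def by real_asymp
    then have "(\<lambda>n. mpow t i * exp (quartic (y n) t)) \<longlonglongrightarrow> mpow t i * exp (quartic x t + \<sigma> * 0 * mpow t i)" for t
      unfolding qy by (intro tendsto_intros)
    then have "(\<lambda>n. LINT t|lebesgue. mpow t i * exp (quartic (y n) t)) \<longlonglongrightarrow> I"
      unfolding I_def using bound
      by (intro integral_dominated_convergence[OF _ _ dom[of i]]) (auto intro!: AE_I2)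
    from tendsto_mult[OF tendsto_const[of \<sigma>] this]
    show ?thesis using step by (intro LIMSEQ_le_const) auto
  qed
  from one_sided[of 1] one_sided[of "-1"] show ?thesis by (simp add: I_def)
qed

theorem proposition8:
  fixes g :: "mindex \<Rightarrow> real" and j :: mindex
  assumes "g \<in> G0" and "5 \<le> mabs j"
  shows "(LINT t|lebesgue. mpow t j * exp (quartic (lambda_star g) t))
    = (\<Sum>i | mabs i \<le> 4. r (lambda_star g) j i * g i)"
proof -
  define x where "x = lambda_star g"
  obtain f where f: "representing_density f g"
    and neg: "\<And>t. t \<noteq> 0 \<Longrightarrow> (\<Sum>i | mabs i = 4. x i * mpow t i) < 0"
    and det: "det (A x) \<noteq> 0"
    using assms(1) unfolding G0_def G_def x_def by blast
  define M where "M i = (LBINT t. mpow t i * exp (quartic x t))" for i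
  have M_lebesgue: "(LINT t|lebesgue. mpow t i * exp (quartic x t)) = M i" for i
    unfolding M_def by (rule integral_completion) measurable
  have M_low: "M i = g i" if "mabs i \<le> 4" for i
    unfolding M_lebesgue[symmetric]
    using lambda_star_maximizes[OF f] neg that
    unfolding x_def[symmetric] by (rule moments_at_maximizer)
  have "(\<Sum>i | mabs i = 4. x i * mpow (1, 0) i) = (\<Sum>i\<in>{(4, 0)}. x i * mpow (1, 0) i)"
    by (rule sum.mono_neutral_right[OF finite_mabs_eq]) (auto simp: mabs_def mpow_def)
  then have x40: "x (4, 0) \<noteq> 0" using neg[of "(1, 0)"] by (simp add: mpow_def zero_prod_def)
  have "M j = (\<Sum>i | mabs i \<le> 4. r x j i * M i)"
  proof (rule moments_by_r, rule moment_reduction[OF x40 det])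
    show "real (fst i) * M (fst i - 1, snd i)
        + (\<Sum>k | mabs k \<le> 3. real (fst k + 1) * x (fst k + 1, snd k) * M (fst i + fst k, snd i + snd k)) = 0"
      and "real (snd i) * M (fst i, snd i - 1)
        + (\<Sum>k | mabs k \<le> 3. real (snd k + 1) * x (fst k, snd k + 1) * M (fst i + fst k, snd i + snd k)) = 0" for i
      unfolding M_def by (rule integration_by_parts[OF neg], assumption)+
  qed
  also have "\<dots> = (\<Sum>i | mabs i \<le> 4. r x j i * g i)"
    by (intro sum.cong refl) (simp add: M_low)
  finally show ?thesis by (simp add: M_lebesgue x_def[symmetric])
qed

end
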